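(* Let $L$ be an arbitrary field and let $\{\Gamma_i\}_{i\in\mathbb{N}}$ be a family of finite connected simplicial graphs which is a graph expander family. For each $i$ write $V_i=H^1(A(\Gamma_i),L)$, $W_i=H^2(A(\Gamma_i),L)$, and let $q_i=\smile\colon V_i\times V_i\to W_i$ be the cup product. For each $i$ choose an arbitrary vertex $v^i$ of $\Gamma_i$. Set $V_i'=V_i$ and $W_i'=W_i\oplus L$, where the summand $L$ is generated by a vector $z_i^*$. Set $q_i'=q_i\oplus q_{0,i}\colon V_i'\times V_i'\to W_i'$, where $q_{0,i}\colon V_i\times V_i\to L z_i^*$ is defined on the basis $\{v^*\mid v\in\mathrm{Vert}(\Gamma_i)\}$ of $V_i$ by $q_{0,i}((v^i)^*,(v^i)^* )=z_i^*$ and $q_{0,i}(v^*,w^* )=0$ unless both $v$ and $w$ are equal to $v^i$, and is extended by bilinearity. Let $\mathcal{V}'=\{(V_i',W_i',q_i')\}_{i}$. Then: (1) The family $\mathcal{V}'$ is a vector space expander family. (2) The family $\mathcal{V}'$ does not arise from the cohomology of the right-angled Artin groups associated to a sequence of graphs; that is, there is no family of finite connected simplicial graphs $\{\Lambda_i\}_{i\in\mathbb{N}}$ such that $V_i'=H^1(A(\Lambda_i),L)$, $W_i'=H^2(A(\Lambda_i),L)$, and $q_i'=\smile$.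
   Context: A simplicial graph is an undirected graph with no multiple edges and no loops. The right-angled Artin group on a finite simplicial graph $\Gamma$ is $A(\Gamma)=\langle \mathrm{Vert}(\Gamma)\mid [v,w]=1 \text{ if and only if } \{v,w\}\in\mathrm{Edge}(\Gamma)\rangle$. $H^k(A(\Gamma),L)$ is group cohomology with trivial coefficients in $L$, and $\smile$ is the cup product $H^1\times H^1\to H^2$. For a vertex $v$, $v^*\in H^1(A(\Gamma),L)$ denotes the class dual to $v$, i.e. the homomorphism $A(\Gamma)\to L$ sending the generator $v$ to $1$ and all other vertex generators to $0$; the classes $v^*$ form a basis of $H^1(A(\Gamma),L)$. Graph expander family: for a finite graph $\Gamma$ and nonempty $A\subset\mathrm{Vert}(\Gamma)$, $\partial A$ is the set of vertices not in $A$ which are adjacent to a vertex of $A$. The Cheeger constant is $h_\Gamma=\min_A|\partial A|/|A|$, over nonempty $A$ with $|A|\le|\mathrm{Vert}(\Gamma)|/2$. A sequence $\{\Gamma_i\}_{i\in\mathbb{N}}$ of finite connected graphs is a graph expander family if $|\mathrm{Vert}(\Gamma_i)|\to\infty$, the valences of vertices of $\Gamma_i$ are bounded independently of $i$, and $\inf_i h_{\Gamma_i}>0$. Triples: throughout, a triple $(V,W,q)$ consists of a finite dimensional $L$-vector space $V$, an $L$-vector space $W$, and a bilinear pairing $q\colon V\times V\to W$. All bilinear pairings in such triples are assumed to be symmetric or anti-symmetric, so that $q(v,w)=\pm q(w,v)$ for all $v,w\in V$. Cheeger constant of a triple: for a subspace $F\subset V$ with $0<\dim F\le(\dim V)/2$,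 let $C=\{v\in V\mid q(f,v)=0\text{ for all }f\in F\}$ and $$h_F=\frac{\dim V-\dim F-\dim C+\dim(C\cap F)}{\dim F};$$ then $h_V=\inf_F h_F$ over all such $F$. $q$-valence: for $\emptyset\ne S\subset V$ and a basis $B$ of $V$, let $d_B(S)=\max_{s\in S}|\{b\in B\mid q(s,b)\ne0\}|$, $d(S)=\min_{B\text{ a basis}}d_B(S)$, and $d(V)=\min_{S\text{ spans }V}d(S)$. Vector space expander family: a family $\{(V_i,W_i,q_i)\}_{i}$ of such triples (with each $q_i$ symmetric or anti-symmetric, as assumed above) is a vector space expander family if (1) $\lim_{i\to\infty}\dim V_i=\infty$; (2) there exists $N$ such that $d(V_i)\le N$ for all $i$; (3) $\inf_i h_{V_i}>0$.
   Formalization: The standing assumption that q' be symmetric or anti-symmetric fails for q_i ⊕ q_{0,i} when char L ≠ 2; it is replaced by: symmetric in one summand of the target and anti-symmetric in an independent one. Part (2) is read up to isomorphism of triples. *)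

theory Defs
  imports "HOL-Algebra.AbelCoset" "Jordan_Normal_Form.Missing_VectorSpace" "HOL-Library.Extended_Real"
begin

section \<open>Finite simplicial graphs and graph expander families\<close>

record 'v sgraph =
  verts :: "'v set"
  edges :: "'v set set"

definition fin_simplicial :: "'v sgraph \<Rightarrow> bool" where
  "fin_simplicial \<Gamma> \<longleftrightarrow> finite (verts \<Gamma>) \<and>
     edges \<Gamma> \<subseteq> {{v, w} | v w. v \<in> verts \<Gamma> \<and> w \<in> verts \<Gamma> \<and> v \<noteq> w}"

definition connected_graph :: "'v sgraph \<Rightarrow> bool" where
  "connected_graph \<Gamma> \<longleftrightarrow> verts \<Gamma> \<noteq> {} \<and>
     (\<forall>v\<in>verts \<Gamma>. \<forall>w\<in>verts \<Gamma>. (v, w) \<in> {(x, y). {x, y} \<in> edges \<Gamma>}\<^sup>*)"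

definition vertex_boundary :: "'v sgraph \<Rightarrow> 'v set \<Rightarrow> 'v set" where
  "vertex_boundary \<Gamma> A = {w \<in> verts \<Gamma> - A. \<exists>v\<in>A. {v, w} \<in> edges \<Gamma>}"

text \<open>Cheeger constants, here and for triples below, take values in the extended reals, so that the
  infimum over an empty index set (a one-vertex graph, a space of dimension at most one) is
  \<open>\<infinity>\<close> and imposes no condition.\<close>

definition graph_cheeger :: "'v sgraph \<Rightarrow> ereal" where
  "graph_cheeger \<Gamma> =
     (INF A\<in>{A. A \<subseteq> verts \<Gamma> \<and> A \<noteq> {} \<and> 2 * card A \<le> card (verts \<Gamma>)}.
        ereal (real (card (vertex_boundary \<Gamma> A)) / real (card A)))"

definition graph_expander_family :: "(nat \<Rightarrow> 'v sgraph) \<Rightarrow> bool" where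
  "graph_expander_family \<Gamma> \<longleftrightarrow>
     (\<forall>i. fin_simplicial (\<Gamma> i) \<and> connected_graph (\<Gamma> i)) \<and>
     filterlim (\<lambda>i. card (verts (\<Gamma> i))) at_top sequentially \<and>
     (\<exists>N. \<forall>i. \<forall>v\<in>verts (\<Gamma> i). card {w \<in> verts (\<Gamma> i). {v, w} \<in> edges (\<Gamma> i)} \<le> N) \<and>
     0 < (INF i. graph_cheeger (\<Gamma> i))"


section \<open>Presented groups and right-angled Artin groups\<close>

text \<open>The letter \<open>(s, True)\<close> stands for the generator \<open>s\<close> and \<open>(s, False)\<close> for its inverse.\<close>

type_synonym 's word = "('s \<times> bool) list"

definition words :: "'s set \<Rightarrow> 's word set" where
  "words S = lists (S \<times> UNIV)"

inductive pres_eq :: "'s set \<Rightarrow> 's word set \<Rightarrow> 's word \<Rightarrow> 's word \<Rightarrow> bool"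
  for S :: "'s set" and R :: "'s word set" where
  refl: "w \<in> words S \<Longrightarrow> pres_eq S R w w"
| sym: "pres_eq S R u w \<Longrightarrow> pres_eq S R w u"
| trans: "pres_eq S R u v \<Longrightarrow> pres_eq S R v w \<Longrightarrow> pres_eq S R u w"
| cancel: "x \<in> words S \<Longrightarrow> y \<in> words S \<Longrightarrow> s \<in> S \<Longrightarrow>
    pres_eq S R (x @ [(s, b), (s, \<not> b)] @ y) (x @ y)"
| relator: "x \<in> words S \<Longrightarrow> y \<in> words S \<Longrightarrow> r \<in> R \<Longrightarrow> pres_eq S R (x @ r @ y) (x @ y)"

definition pres_class :: "'s set \<Rightarrow> 's word set \<Rightarrow> 's word \<Rightarrow> 's word set" where
  "pres_class S R w = {w'. pres_eq S R w w'}"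

text \<open>The group \<open>\<langle>S | R\<rangle>\<close>, for a set \<open>R\<close> of words over \<open>S\<close>.\<close>

definition pres_group :: "'s set \<Rightarrow> 's word set \<Rightarrow> 's word set monoid" where
  "pres_group S R =
     \<lparr>carrier = pres_class S R ` words S,
      mult = (\<lambda>X Y. \<Union>x\<in>X. \<Union>y\<in>Y. pres_class S R (x @ y)),
      one = pres_class S R []\<rparr>"

definition raag_relators :: "'v sgraph \<Rightarrow> 'v word set" where
  "raag_relators \<Gamma> =
     {[(v, True), (w, True), (v, False), (w, False)] | v w. {v, w} \<in> edges \<Gamma>}"

definition raag :: "'v sgraph \<Rightarrow> 'v word set monoid" where
  "raag \<Gamma> = pres_group (verts \<Gamma>) (raag_relators \<Gamma>)"

definition raag_gen :: "'v sgraph \<Rightarrow> 'v \<Rightarrow> 'v word set" where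
  "raag_gen \<Gamma> v = pres_class (verts \<Gamma>) (raag_relators \<Gamma>) [(v, True)]"


section \<open>Group cohomology with trivial coefficients\<close>

text \<open>Inhomogeneous cochains: an \<open>n\<close>-tuple of group elements is a list of length \<open>n\<close>.\<close>

definition tuples :: "('g, 'b) monoid_scheme \<Rightarrow> nat \<Rightarrow> 'g list set" where
  "tuples G n = {xs. length xs = n \<and> set xs \<subseteq> carrier G}"

definition cochains ::
  "('l, 'm) ring_scheme \<Rightarrow> ('g, 'b) monoid_scheme \<Rightarrow> nat \<Rightarrow> ('l, 'g list \<Rightarrow> 'l) module" where
  "cochains L G n = ring.func_space L (tuples G n)"

definition bar_face :: "('g, 'b) monoid_scheme \<Rightarrow> nat \<Rightarrow> 'g list \<Rightarrow> 'g list" where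
  "bar_face G i xs =
     (if i = 0 then tl xs
      else if i = length xs then butlast xs
      else take (i - 1) xs @ [xs ! (i - 1) \<otimes>\<^bsub>G\<^esub> xs ! i] @ drop (i + 1) xs)"

definition coboundary_map ::
  "('l, 'm) ring_scheme \<Rightarrow> ('g, 'b) monoid_scheme \<Rightarrow> nat \<Rightarrow> ('g list \<Rightarrow> 'l) \<Rightarrow> 'g list \<Rightarrow> 'l" where
  "coboundary_map L G n f =
     (\<lambda>xs\<in>tuples G (Suc n).
        \<Oplus>\<^bsub>L\<^esub>i\<in>{..Suc n}. ((\<ominus>\<^bsub>L\<^esub> \<one>\<^bsub>L\<^esub>) [^]\<^bsub>L\<^esub> i) \<otimes>\<^bsub>L\<^esub> f (bar_face G i xs))"

definition cocycles ::
  "('l, 'm) ring_scheme \<Rightarrow> ('g, 'b) monoid_scheme \<Rightarrow> nat \<Rightarrow> ('g list \<Rightarrow> 'l) set" where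
  "cocycles L G n =
     {f \<in> carrier (cochains L G n). coboundary_map L G n f = \<zero>\<^bsub>cochains L G (Suc n)\<^esub>}"

definition coboundaries ::
  "('l, 'm) ring_scheme \<Rightarrow> ('g, 'b) monoid_scheme \<Rightarrow> nat \<Rightarrow> ('g list \<Rightarrow> 'l) set" where
  "coboundaries L G n =
     (if n = 0 then {\<zero>\<^bsub>cochains L G 0\<^esub>}
      else coboundary_map L G (n - 1) ` carrier (cochains L G (n - 1)))"

text \<open>Quotient of a module \<open>M\<close> by a submodule \<open>N\<close>. The fields \<open>mult\<close> and \<open>one\<close> of a module record
  carry no information.\<close>

definition quot_module :: "('l, 'a, 'd) module_scheme \<Rightarrow> 'a set \<Rightarrow> ('l, 'a set) module" where
  "quot_module M N =
     \<lparr>carrier = a_rcosets\<^bsub>M\<^esub> N,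
      mult = (\<lambda>X Y. N),
      one = N,
      zero = N,
      add = (\<lambda>X Y. X <+>\<^bsub>M\<^esub> Y),
      smult = (\<lambda>c X. \<Union>x\<in>X. N +>\<^bsub>M\<^esub> (c \<odot>\<^bsub>M\<^esub> x))\<rparr>"

definition cohomology ::
  "('l, 'm) ring_scheme \<Rightarrow> ('g, 'b) monoid_scheme \<Rightarrow> nat \<Rightarrow> ('l, ('g list \<Rightarrow> 'l) set) module" where
  "cohomology L G n =
     quot_module ((cochains L G n)\<lparr>carrier := cocycles L G n\<rparr>) (coboundaries L G n)"

definition cup_cochain ::
  "('l, 'm) ring_scheme \<Rightarrow> ('g, 'b) monoid_scheme \<Rightarrow> nat \<Rightarrow> nat \<Rightarrow>
     ('g list \<Rightarrow> 'l) \<Rightarrow> ('g list \<Rightarrow> 'l) \<Rightarrow> 'g list \<Rightarrow> 'l" where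
  "cup_cochain L G p q f g = (\<lambda>xs\<in>tuples G (p + q). f (take p xs) \<otimes>\<^bsub>L\<^esub> g (drop p xs))"

definition cup ::
  "('l, 'm) ring_scheme \<Rightarrow> ('g, 'b) monoid_scheme \<Rightarrow> nat \<Rightarrow> nat \<Rightarrow>
     ('g list \<Rightarrow> 'l) set \<Rightarrow> ('g list \<Rightarrow> 'l) set \<Rightarrow> ('g list \<Rightarrow> 'l) set" where
  "cup L G p q X Y =
     (\<Union>f\<in>X. \<Union>g\<in>Y. coboundaries L G (p + q) +>\<^bsub>cochains L G (p + q)\<^esub> cup_cochain L G p q f g)"

abbreviation raag_H ::
  "('l, 'm) ring_scheme \<Rightarrow> 'v sgraph \<Rightarrow> nat \<Rightarrow> ('l, ('v word set list \<Rightarrow> 'l) set) module" where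
  "raag_H L \<Gamma> n \<equiv> cohomology L (raag \<Gamma>) n"

abbreviation raag_cup ::
  "('l, 'm) ring_scheme \<Rightarrow> 'v sgraph \<Rightarrow>
     ('v word set list \<Rightarrow> 'l) set \<Rightarrow> ('v word set list \<Rightarrow> 'l) set \<Rightarrow> ('v word set list \<Rightarrow> 'l) set" where
  "raag_cup L \<Gamma> \<equiv> cup L (raag \<Gamma>) 1 1"

definition dual_class ::
  "('l, 'm) ring_scheme \<Rightarrow> 'v sgraph \<Rightarrow> 'v \<Rightarrow> ('v word set list \<Rightarrow> 'l) set" where
  "dual_class L \<Gamma> v =
     (THE c. c \<in> carrier (raag_H L \<Gamma> 1) \<and>
        (\<forall>f\<in>c. \<forall>u\<in>verts \<Gamma>. f [raag_gen \<Gamma> u] = (if u = v then \<one>\<^bsub>L\<^esub> else \<zero>\<^bsub>L\<^esub>)))"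


section \<open>Triples and vector space expander families\<close>

definition bilinear_pairing ::
  "('l, 'm) ring_scheme \<Rightarrow> ('l, 'a, 'd) module_scheme \<Rightarrow> ('l, 'b, 'e) module_scheme \<Rightarrow>
     ('a \<Rightarrow> 'a \<Rightarrow> 'b) \<Rightarrow> bool" where
  "bilinear_pairing L V W q \<longleftrightarrow>
     (\<forall>x\<in>carrier V. (\<lambda>y. q x y) \<in> LinearCombinations.module_hom L V W \<and> (\<lambda>y. q y x) \<in> LinearCombinations.module_hom L V W)"

text \<open>The requirement \<open>q(v, w) = \<plusminus>q(w, v)\<close>. The sign is fixed on each of two independent summands
  \<open>P\<close>, \<open>M\<close> of the target: \<open>q\<close> is symmetric in its \<open>P\<close>-component and anti-symmetric in its
  \<open>M\<close>-component. With \<open>M = 0\<close> this is symmetry and with \<open>P = 0\<close> anti-symmetry; in characteristic two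
  it is equivalent to symmetry. A single sign for the whole target would exclude the direct sum of
  an anti-symmetric pairing (such as the cup product on first cohomology) and a symmetric pairing
  when both are nonzero and the characteristic is not two.\<close>

definition sym_antisym_pairing ::
  "('l, 'm) ring_scheme \<Rightarrow> ('l, 'a, 'd) module_scheme \<Rightarrow> ('l, 'b, 'e) module_scheme \<Rightarrow>
     ('a \<Rightarrow> 'a \<Rightarrow> 'b) \<Rightarrow> bool" where
  "sym_antisym_pairing L V W q \<longleftrightarrow>
     (\<exists>P M. VectorSpace.subspace L P W \<and> VectorSpace.subspace L M W \<and> P \<inter> M = {\<zero>\<^bsub>W\<^esub>} \<and>
        (\<forall>x\<in>carrier V. \<forall>y\<in>carrier V. \<exists>s\<in>P. \<exists>a\<in>M.
           q x y = s \<oplus>\<^bsub>W\<^esub> a \<and> q y x = s \<ominus>\<^bsub>W\<^esub> a))"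

definition is_triple ::
  "('l, 'm) ring_scheme \<Rightarrow> ('l, 'a, 'd) module_scheme \<Rightarrow> ('l, 'b, 'e) module_scheme \<Rightarrow>
     ('a \<Rightarrow> 'a \<Rightarrow> 'b) \<Rightarrow> bool" where
  "is_triple L V W q \<longleftrightarrow>
     vectorspace L V \<and> vectorspace.fin_dim L V \<and> vectorspace L W \<and>
     bilinear_pairing L V W q \<and> sym_antisym_pairing L V W q"

definition subdim :: "('l, 'm) ring_scheme \<Rightarrow> ('l, 'a, 'd) module_scheme \<Rightarrow> 'a set \<Rightarrow> nat" where
  "subdim L V F = vectorspace.dim L (V\<lparr>carrier := F\<rparr>)"

definition annihilator ::
  "('l, 'a, 'd) module_scheme \<Rightarrow> ('l, 'b, 'e) module_scheme \<Rightarrow> ('a \<Rightarrow> 'a \<Rightarrow> 'b) \<Rightarrow> 'a set \<Rightarrow> 'a set" where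
  "annihilator V W q F = {v \<in> carrier V. \<forall>f\<in>F. q f v = \<zero>\<^bsub>W\<^esub>}"

definition triple_cheeger_at ::
  "('l, 'm) ring_scheme \<Rightarrow> ('l, 'a, 'd) module_scheme \<Rightarrow> ('l, 'b, 'e) module_scheme \<Rightarrow>
     ('a \<Rightarrow> 'a \<Rightarrow> 'b) \<Rightarrow> 'a set \<Rightarrow> real" where
  "triple_cheeger_at L V W q F =
     (let C = annihilator V W q F in
        (real (vectorspace.dim L V) - real (subdim L V F) - real (subdim L V C)
           + real (subdim L V (C \<inter> F))) / real (subdim L V F))"

definition triple_cheeger ::
  "('l, 'm) ring_scheme \<Rightarrow> ('l, 'a, 'd) module_scheme \<Rightarrow> ('l, 'b, 'e) module_scheme \<Rightarrow>
     ('a \<Rightarrow> 'a \<Rightarrow> 'b) \<Rightarrow> ereal" where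
  "triple_cheeger L V W q =
     (INF F\<in>{F. VectorSpace.subspace L F V \<and> 0 < subdim L V F \<and> 2 * subdim L V F \<le> vectorspace.dim L V}.
        ereal (triple_cheeger_at L V W q F))"

text \<open>The maximum over a possibly infinite \<open>S\<close> is over a finite set of naturals, since each value is
  at most \<open>card B\<close>.\<close>

definition valence_basis ::
  "('l, 'b, 'e) module_scheme \<Rightarrow> ('a \<Rightarrow> 'a \<Rightarrow> 'b) \<Rightarrow> 'a set \<Rightarrow> 'a set \<Rightarrow> nat" where
  "valence_basis W q B S = Max ((\<lambda>s. card {b \<in> B. q s b \<noteq> \<zero>\<^bsub>W\<^esub>}) ` S)"

definition valence_set ::
  "('l, 'm) ring_scheme \<Rightarrow> ('l, 'a, 'd) module_scheme \<Rightarrow> ('l, 'b, 'e) module_scheme \<Rightarrow>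
     ('a \<Rightarrow> 'a \<Rightarrow> 'b) \<Rightarrow> 'a set \<Rightarrow> nat" where
  "valence_set L V W q S = (INF B\<in>{B. vectorspace.basis L V B}. valence_basis W q B S)"

definition valence ::
  "('l, 'm) ring_scheme \<Rightarrow> ('l, 'a, 'd) module_scheme \<Rightarrow> ('l, 'b, 'e) module_scheme \<Rightarrow>
     ('a \<Rightarrow> 'a \<Rightarrow> 'b) \<Rightarrow> nat" where
  "valence L V W q =
     (INF S\<in>{S. S \<noteq> {} \<and> S \<subseteq> carrier V \<and> LinearCombinations.module.span L V S = carrier V}. valence_set L V W q S)"

definition vs_expander_family ::
  "('l, 'm) ring_scheme \<Rightarrow> (nat \<Rightarrow> ('l, 'a, 'd) module_scheme) \<Rightarrow>
     (nat \<Rightarrow> ('l, 'b, 'e) module_scheme) \<Rightarrow> (nat \<Rightarrow> 'a \<Rightarrow> 'a \<Rightarrow> 'b) \<Rightarrow> bool" where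
  "vs_expander_family L V W q \<longleftrightarrow>
     (\<forall>i. is_triple L (V i) (W i) (q i)) \<and>
     filterlim (\<lambda>i. vectorspace.dim L (V i)) at_top sequentially \<and>
     (\<exists>N. \<forall>i. valence L (V i) (W i) (q i) \<le> N) \<and>
     0 < (INF i. triple_cheeger L (V i) (W i) (q i))"

definition triple_iso ::
  "('l, 'm) ring_scheme \<Rightarrow>
     ('l, 'a, 'd) module_scheme \<Rightarrow> ('l, 'b, 'e) module_scheme \<Rightarrow> ('a \<Rightarrow> 'a \<Rightarrow> 'b) \<Rightarrow>
     ('l, 'a2, 'd2) module_scheme \<Rightarrow> ('l, 'b2, 'e2) module_scheme \<Rightarrow> ('a2 \<Rightarrow> 'a2 \<Rightarrow> 'b2) \<Rightarrow> bool" where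
  "triple_iso L V W q V2 W2 q2 \<longleftrightarrow>
     (\<exists>\<phi> \<psi>. \<phi> \<in> LinearCombinations.module_hom L V V2 \<and> bij_betw \<phi> (carrier V) (carrier V2) \<and>
        \<psi> \<in> LinearCombinations.module_hom L W W2 \<and> bij_betw \<psi> (carrier W) (carrier W2) \<and>
        (\<forall>x\<in>carrier V. \<forall>y\<in>carrier V. q2 (\<phi> x) (\<phi> y) = \<psi> (q x y)))"

text \<open>The field \<open>L\<close> as a one-dimensional vector space over itself, generated by \<open>\<one>\<^bsub>L\<^esub>\<close>.\<close>

definition line :: "('l, 'm) ring_scheme \<Rightarrow> ('l, 'l) module" where
  "line L =
     \<lparr>carrier = carrier L, mult = mult L, one = one L, zero = zero L, add = add L, smult = mult L\<rparr>"

end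

theory Submission
  imports Defs
begin

text \<open>A class of degree one of a right-angled Artin group is a homomorphism to \<open>L\<close>, hence an arbitrary
  labelling of the vertices by elements of \<open>L\<close>. The whole argument rests on one computation
  (\<open>cup_eq_zero_iff_edges\<close>): the cup product of \<open>f\<close> and \<open>g\<close> is zero in the second cohomology if and
  only if \<open>f v * g w = f w * g v\<close> for every edge \<open>{v, w}\<close>. If the product is a coboundary, comparing
  its values at \<open>(v, w)\<close> and \<open>(w, v)\<close> gives the equation. If the equations hold, the elements
  \<open>(f v, g v, 0)\<close> of the Heisenberg group over \<open>L\<close> commute along edges, so that \<open>(f, g)\<close> lifts to a
  homomorphism to the Heisenberg group, whose corner entry exhibits the product as a coboundary.

  The second claim follows because the condition on the edges is satisfied when \<open>f = g\<close>: cup products of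
  right-angled Artin groups are alternating, and the pairing with the added square is not
  (\<open>not_raag_triple\<close>).

  For the first claim, dimensions and valences are read off the dual basis (\<open>valence_le\<close>). The Cheeger
  constant is a question of linear algebra over the graph, settled by \<open>expansion_of_pairing\<close>. Let
  \<open>F\<close> be a subspace of at most half the dimension, with annihilator \<open>C\<close>. A basis of \<open>F\<close> in reduced
  echelon form has a set \<open>P\<close> of pivot vertices with \<open>card P = dim F\<close>. Let \<open>S\<close> be the set of
  pivots at which some element of \<open>C\<close> is nonzero. The conditions on the edges show that the codimension of
  \<open>F + C\<close>, which is the numerator of the Cheeger quotient, is at least \<open>card \<partial>P - card S\<close> and at
  least \<open>card \<partial>S\<close>. If the graph expands by the factor \<open>\<epsilon>\<close>, a combination of both bounds shows that
  the Cheeger constant of the triple is at least \<open>\<epsilon>\<^sup>2 / (1 + \<epsilon>)\<close>.\<close>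

section \<open>Coordinates on finite-dimensional vector spaces\<close>

text \<open>A finite basis \<open>e\<close> together with its dual functionals \<open>x\<close>. The functionals are a separate
  parameter, rather than derived from the basis, so that a subspace with a basis of its own can use
  some of the coordinate functions of the ambient space as its dual functionals; this is what a
  basis in reduced echelon form is.\<close>

locale coordinates = vectorspace K V
  for K :: "('k, 'm) ring_scheme" and V :: "('k, 'a, 'd) module_scheme" +
  fixes I :: "'i set" and e :: "'i \<Rightarrow> 'a" and x :: "'i \<Rightarrow> 'a \<Rightarrow> 'k"
  assumes finite_index: "finite I"
    and e_closed: "i \<in> I \<Longrightarrow> e i \<in> carrier V"
    and x_closed: "\<lbrakk>i \<in> I; v \<in> carrier V\<rbrakk> \<Longrightarrow> x i v \<in> carrier K"
    and x_add: "\<lbrakk>i \<in> I; v \<in> carrier V; w \<in> carrier V\<rbrakk> \<Longrightarrow> x i (v \<oplus>\<^bsub>V\<^esub> w) = x i v \<oplus>\<^bsub>K\<^esub> x i w"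
    and x_smult: "\<lbrakk>i \<in> I; c \<in> carrier K; v \<in> carrier V\<rbrakk> \<Longrightarrow> x i (c \<odot>\<^bsub>V\<^esub> v) = c \<otimes>\<^bsub>K\<^esub> x i v"
    and x_dual: "\<lbrakk>i \<in> I; j \<in> I\<rbrakk> \<Longrightarrow> x i (e j) = (if i = j then \<one>\<^bsub>K\<^esub> else \<zero>\<^bsub>K\<^esub>)"
    and x_separates: "\<lbrakk>v \<in> carrier V; \<And>i. i \<in> I \<Longrightarrow> x i v = \<zero>\<^bsub>K\<^esub>\<rbrakk> \<Longrightarrow> v = \<zero>\<^bsub>V\<^esub>"
begin

lemma x_zero: "i \<in> I \<Longrightarrow> x i \<zero>\<^bsub>V\<^esub> = \<zero>\<^bsub>K\<^esub>"
  using x_smult[of i "\<zero>\<^bsub>K\<^esub>" "\<zero>\<^bsub>V\<^esub>"] x_closed[of i "\<zero>\<^bsub>V\<^esub>"] by simp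

lemma x_minus:
  assumes "i \<in> I" "v \<in> carrier V" "w \<in> carrier V"
  shows "x i (v \<ominus>\<^bsub>V\<^esub> w) = x i v \<ominus>\<^bsub>K\<^esub> x i w"
proof -
  have "v \<ominus>\<^bsub>V\<^esub> w = v \<oplus>\<^bsub>V\<^esub> (\<ominus>\<^bsub>K\<^esub> \<one>\<^bsub>K\<^esub>) \<odot>\<^bsub>V\<^esub> w"
    using assms by (simp add: a_minus_def smult_minus_1)
  then show ?thesis
    using assms x_add[of i v "(\<ominus>\<^bsub>K\<^esub> \<one>\<^bsub>K\<^esub>) \<odot>\<^bsub>V\<^esub> w"] x_smult[of i "\<ominus>\<^bsub>K\<^esub> \<one>\<^bsub>K\<^esub>" w] x_closed[of i w]
    by (simp add: a_minus_def R.l_minus)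
qed

lemma x_finsum:
  assumes "i \<in> I" "finite A" "g \<in> A \<rightarrow> carrier V"
  shows "x i (\<Oplus>\<^bsub>V\<^esub>a\<in>A. g a) = (\<Oplus>\<^bsub>K\<^esub>a\<in>A. x i (g a))"
  using assms(2,3)
proof (induction A rule: finite_induct)
  case empty
  then show ?case using x_zero assms(1) by simp
next
  case (insert a A)
  then have 1: "g \<in> A \<rightarrow> carrier V" "g a \<in> carrier V" by auto
  have 2: "(\<lambda>a. x i (g a)) \<in> A \<rightarrow> carrier K" "x i (g a) \<in> carrier K"
    using 1 x_closed assms(1) by auto
  show ?case
    using insert 1 2 by (simp add: M.finsum_insert R.finsum_insert x_add assms(1) M.finsum_closed)
qed

lemma x_lincomb:
  assumes "i \<in> I" "J \<subseteq> I" "a \<in> J \<rightarrow> carrier K"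
  shows "x i (\<Oplus>\<^bsub>V\<^esub>j\<in>J. a j \<odot>\<^bsub>V\<^esub> e j) = (if i \<in> J then a i else \<zero>\<^bsub>K\<^esub>)"
proof -
  have fin: "finite J" using assms finite_index finite_subset by blast
  have cl: "(\<lambda>j. a j \<odot>\<^bsub>V\<^esub> e j) \<in> J \<rightarrow> carrier V"
    using assms e_closed by auto
  have "x i (\<Oplus>\<^bsub>V\<^esub>j\<in>J. a j \<odot>\<^bsub>V\<^esub> e j) = (\<Oplus>\<^bsub>K\<^esub>j\<in>J. x i (a j \<odot>\<^bsub>V\<^esub> e j))"
    by (rule x_finsum[OF assms(1) fin cl])
  also have "\<dots> = (\<Oplus>\<^bsub>K\<^esub>j\<in>J. if i = j then a j else \<zero>\<^bsub>K\<^esub>)"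
    using assms e_closed by (intro R.finsum_cong') (auto simp: x_smult x_dual Pi_iff subset_iff)
  also have "\<dots> = (if i \<in> J then a i else \<zero>\<^bsub>K\<^esub>)"
  proof (cases "i \<in> J")
    case True
    then show ?thesis using R.finsum_singleton[OF True fin assms(3)] by simp
  next
    case False
    then have "(\<Oplus>\<^bsub>K\<^esub>j\<in>J. if i = j then a j else \<zero>\<^bsub>K\<^esub>) = (\<Oplus>\<^bsub>K\<^esub>j\<in>J. \<zero>\<^bsub>K\<^esub>)"
      by (intro R.finsum_cong') auto
    with False show ?thesis by simp
  qed
  finally show ?thesis .
qed

lemma x_inject:
  assumes "v \<in> carrier V" "w \<in> carrier V" "\<And>i. i \<in> I \<Longrightarrow> x i v = x i w"
  shows "v = w"
proof -
  have "v \<ominus>\<^bsub>V\<^esub> w = \<zero>\<^bsub>V\<^esub>"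
    using assms x_closed by (intro x_separates) (auto simp: x_minus)
  then show ?thesis using assms by simp
qed

lemma expansion:
  assumes "v \<in> carrier V"
  shows "v = (\<Oplus>\<^bsub>V\<^esub>i\<in>I. x i v \<odot>\<^bsub>V\<^esub> e i)"
  using assms x_closed e_closed
  by (intro x_inject M.finsum_closed) (auto simp: x_lincomb)

lemma e_inj: "inj_on e I"
  using x_dual unfolding inj_on_def by (metis one_not_zero)

lemma basis_e: "basis (e ` I)"
proof -
  have sub: "e ` I \<subseteq> carrier V" using e_closed by auto
  have lc: "lincomb a (e ` I) = (\<Oplus>\<^bsub>V\<^esub>i\<in>I. a (e i) \<odot>\<^bsub>V\<^esub> e i)" if "a \<in> e ` I \<rightarrow> carrier K" for a
    unfolding lincomb_def using that e_closed by (subst M.finsum_reindex) (auto simp: e_inj)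
  have "lin_indpt (e ` I)"
  proof (rule finite_lin_indpt2)
    fix a assume a: "a \<in> e ` I \<rightarrow> carrier K" and 0: "lincomb a (e ` I) = \<zero>\<^bsub>V\<^esub>"
    have "a (e i) = \<zero>\<^bsub>K\<^esub>" if "i \<in> I" for i
    proof -
      have "(\<lambda>i. a (e i)) \<in> I \<rightarrow> carrier K" using a by auto
      from x_lincomb[OF that subset_refl this] show ?thesis using that 0 lc[OF a] x_zero[of i] by simp
    qed
    then show "\<forall>v\<in>e ` I. a v = \<zero>\<^bsub>K\<^esub>" by auto
  qed (use sub finite_index in auto)
  moreover have "span (e ` I) = carrier V"
  proof
    show "span (e ` I) \<subseteq> carrier V" using sub by (rule span_is_subset2)
    show "carrier V \<subseteq> span (e ` I)"
    proof
      fix v assume v: "v \<in> carrier V"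
      define a where "a u = x (the_inv_into I e u) v" for u
      have ae: "a (e i) = x i v" if "i \<in> I" for i
        using that by (simp add: a_def the_inv_into_f_f e_inj)
      have a: "a \<in> e ` I \<rightarrow> carrier K" using ae v x_closed by auto
      have "lincomb a (e ` I) = (\<Oplus>\<^bsub>V\<^esub>i\<in>I. x i v \<odot>\<^bsub>V\<^esub> e i)"
        unfolding lc[OF a] using ae v x_closed e_closed by (intro M.finsum_cong') auto
      also have "\<dots> = v" using expansion[OF v] by simp
      finally show "v \<in> span (e ` I)"
        using a finite_index unfolding span_def by blast
    qed
  qed
  ultimately show ?thesis unfolding basis_def using sub by blast
qed

lemma dim_eq_card: "dim = card I"
  using dim_basis[OF _ basis_e] finite_index card_image[OF e_inj] by simp

lemma fin_dim: "fin_dim"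
  using basis_e finite_index unfolding basis_def fin_dim_def by (intro exI[of _ "e ` I"]) simp

lemma hom_eqI:
  assumes W: "vectorspace K W"
    and g: "g \<in> LinearCombinations.module_hom K V W" and h: "h \<in> LinearCombinations.module_hom K V W"
    and eq: "\<And>i. i \<in> I \<Longrightarrow> g (e i) = h (e i)" and v: "v \<in> carrier V"
  shows "g v = h v"
proof -
  interpret W: vectorspace K W by fact
  interpret g: mod_hom K V W g
    using g by unfold_locales
  interpret h: mod_hom K V W h
    using h by unfold_locales
  have cl: "(\<lambda>i. x i v \<odot>\<^bsub>V\<^esub> e i) \<in> I \<rightarrow> carrier V" using v x_closed e_closed by auto
  have *: "f (\<Oplus>\<^bsub>V\<^esub>i\<in>I. x i v \<odot>\<^bsub>V\<^esub> e i) = (\<Oplus>\<^bsub>W\<^esub>i\<in>I. x i v \<odot>\<^bsub>W\<^esub> f (e i))"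
    if f: "mod_hom K V W f" for f
  proof -
    interpret f: mod_hom K V W f by fact
    have "J \<subseteq> I \<Longrightarrow> f (\<Oplus>\<^bsub>V\<^esub>i\<in>J. x i v \<odot>\<^bsub>V\<^esub> e i) = (\<Oplus>\<^bsub>W\<^esub>i\<in>J. x i v \<odot>\<^bsub>W\<^esub> f (e i))" for J
    proof (induction J rule: infinite_finite_induct)
      case (infinite J)
      then show ?case using finite_index finite_subset by blast
    next
      case (insert i J)
      then have "(\<lambda>i. x i v \<odot>\<^bsub>V\<^esub> e i) \<in> J \<rightarrow> carrier V" "x i v \<in> carrier K" "e i \<in> carrier V"
        "(\<lambda>i. x i v \<odot>\<^bsub>W\<^esub> f (e i)) \<in> J \<rightarrow> carrier W"
        using v x_closed e_closed by auto
      with insert show ?case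
        by (simp add: M.finsum_insert W.M.finsum_insert M.finsum_closed)
    qed simp
    then show ?thesis by blast
  qed
  have "g v = (\<Oplus>\<^bsub>W\<^esub>i\<in>I. x i v \<odot>\<^bsub>W\<^esub> g (e i))"
    using *[OF g.mod_hom_axioms] expansion[OF v] by simp
  also have "\<dots> = (\<Oplus>\<^bsub>W\<^esub>i\<in>I. x i v \<odot>\<^bsub>W\<^esub> h (e i))"
    using v x_closed e_closed eq by (intro W.M.finsum_cong') auto
  also have "\<dots> = h v"
    using *[OF h.mod_hom_axioms] expansion[OF v] by simp
  finally show ?thesis .
qed

lemma subspace_closed:
  assumes "VectorSpace.subspace K U V"
  shows "v \<in> U \<Longrightarrow> v \<in> carrier V"
    and "\<zero>\<^bsub>V\<^esub> \<in> U"
    and "\<lbrakk>v \<in> U; w \<in> U\<rbrakk> \<Longrightarrow> v \<oplus>\<^bsub>V\<^esub> w \<in> U"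
    and "\<lbrakk>c \<in> carrier K; v \<in> U\<rbrakk> \<Longrightarrow> c \<odot>\<^bsub>V\<^esub> v \<in> U"
    and "\<lbrakk>v \<in> U; w \<in> U\<rbrakk> \<Longrightarrow> v \<ominus>\<^bsub>V\<^esub> w \<in> U"
proof -
  interpret U: submodule K U V using assms by (simp add: subspace_def)
  show sub: "v \<in> U \<Longrightarrow> v \<in> carrier V" for v using U.subset by auto
  show "\<zero>\<^bsub>V\<^esub> \<in> U" by simp
  show "\<lbrakk>v \<in> U; w \<in> U\<rbrakk> \<Longrightarrow> v \<oplus>\<^bsub>V\<^esub> w \<in> U" by simp
  show sm: "\<lbrakk>c \<in> carrier K; v \<in> U\<rbrakk> \<Longrightarrow> c \<odot>\<^bsub>V\<^esub> v \<in> U" for c v by simp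
  assume vw: "v \<in> U" "w \<in> U"
  have "v \<ominus>\<^bsub>V\<^esub> w = v \<oplus>\<^bsub>V\<^esub> (\<ominus>\<^bsub>K\<^esub> \<one>\<^bsub>K\<^esub>) \<odot>\<^bsub>V\<^esub> w"
    using vw sub by (simp add: a_minus_def smult_minus_1)
  then show "v \<ominus>\<^bsub>V\<^esub> w \<in> U" using vw by simp
qed

text \<open>Reduced echelon form. Among the sets of coordinates in \<open>T\<close> for which \<open>U\<close> contains a dual system,
  take a maximal one \<open>P\<close>. A nonzero vector of \<open>U\<close> that vanishes on \<open>P\<close> would have a nonzero entry at
  some \<open>t\<close> in \<open>T\<close>; scaled to have entry one there and used to clear the entries at \<open>t\<close> of the
  dual system, it would give a dual system for \<open>insert t P\<close>.\<close>

lemma pivots: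
  assumes U: "VectorSpace.subspace K U V" and T: "T \<subseteq> I"
    and sep: "\<And>v. \<lbrakk>v \<in> U; \<And>t. t \<in> T \<Longrightarrow> x t v = \<zero>\<^bsub>K\<^esub>\<rbrakk> \<Longrightarrow> v = \<zero>\<^bsub>V\<^esub>"
  obtains P f where "P \<subseteq> T" "coordinates K (vs U) P f x"
proof -
  note Ucl = subspace_closed[OF U]
  define dual where "dual P f \<longleftrightarrow> (\<forall>p\<in>P. f p \<in> U) \<and>
    (\<forall>p\<in>P. \<forall>q\<in>P. x p (f q) = (if p = q then \<one>\<^bsub>K\<^esub> else \<zero>\<^bsub>K\<^esub>))" for P f
  have finT: "finite T" using T finite_index finite_subset by blast
  define good where "good = {P. P \<subseteq> T \<and> (\<exists>f. dual P f)}"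
  have "finite good" unfolding good_def using finT by simp
  moreover have "{} \<in> good" unfolding good_def dual_def by simp
  ultimately obtain P where P: "P \<in> good" and max: "\<And>Q. \<lbrakk>Q \<in> good; P \<subseteq> Q\<rbrakk> \<Longrightarrow> P = Q"
    using finite_has_maximal[of good] by blast
  obtain f where PT: "P \<subseteq> T" and f: "dual P f" using P unfolding good_def by blast
  have PI: "P \<subseteq> I" using PT T by blast
  have zero: "v = \<zero>\<^bsub>V\<^esub>" if v: "v \<in> U" and vP: "\<And>p. p \<in> P \<Longrightarrow> x p v = \<zero>\<^bsub>K\<^esub>" for v
  proof (rule sep[OF v], rule ccontr)
    fix t assume t: "t \<in> T" and nz: "x t v \<noteq> \<zero>\<^bsub>K\<^esub>"
    have tP: "t \<notin> P" using nz vP by blast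
    have tI: "t \<in> I" using t T by blast
    have vV: "v \<in> carrier V" using v Ucl by blast
    have unit: "x t v \<in> Units K"
      using nz x_closed[OF tI vV] field_Units by simp
    define u where "u = inv\<^bsub>K\<^esub> (x t v) \<odot>\<^bsub>V\<^esub> v"
    have icl: "inv\<^bsub>K\<^esub> (x t v) \<in> carrier K" using unit by simp
    have u: "u \<in> U" "u \<in> carrier V" using v icl Ucl by (auto simp: u_def)
    have ut: "x t u = \<one>\<^bsub>K\<^esub>"
      using unit icl vV tI by (simp add: u_def x_smult R.Units_l_inv)
    have uP: "x p u = \<zero>\<^bsub>K\<^esub>" if "p \<in> P" for p
      using that PI vP icl vV by (auto simp: u_def x_smult subset_iff)
    define g where "g p = (if p = t then u else f p \<ominus>\<^bsub>V\<^esub> x t (f p) \<odot>\<^bsub>V\<^esub> u)" for p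
    have fU: "f p \<in> U" "f p \<in> carrier V" "x t (f p) \<in> carrier K" if "p \<in> P" for p
      using that f Ucl x_closed tI unfolding dual_def by auto
    have gU: "g p \<in> U" if "p \<in> insert t P" for p
      using that u fU Ucl by (auto simp: g_def)
    have "x p (g q) = (if p = q then \<one>\<^bsub>K\<^esub> else \<zero>\<^bsub>K\<^esub>)" if p: "p \<in> insert t P" and q: "q \<in> insert t P" for p q
    proof (cases "q = t")
      case True
      then show ?thesis using p ut uP by (auto simp: g_def)
    next
      case False
      then have qP: "q \<in> P" using q by blast
      have pI: "p \<in> I" using p PI tI by blast
      have "x p (g q) = x p (f q) \<ominus>\<^bsub>K\<^esub> x t (f q) \<otimes>\<^bsub>K\<^esub> x p u"
        using False pI fU[OF qP] u by (simp add: g_def x_minus x_smult)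
      also have "\<dots> = (if p = q then \<one>\<^bsub>K\<^esub> else \<zero>\<^bsub>K\<^esub>)"
      proof (cases "p = t")
        case True
        then show ?thesis using ut fU[OF qP] False by simp
      next
        case False
        then have "p \<in> P" using p by blast
        then show ?thesis using uP[of p] fU[OF qP] f qP unfolding dual_def
          by (simp add: R.minus_eq)
      qed
      finally show ?thesis .
    qed
    then have "dual (insert t P) g" using gU unfolding dual_def by blast
    then have "insert t P \<in> good" using PT t unfolding good_def by blast
    then show False using max[of "insert t P"] tP by blast
  qed
  have "coordinates K (vs U) P f x"
  proof (intro coordinates.intro coordinates_axioms.intro)
    show "vectorspace K (vs U)" by (rule subspace_is_vs[OF U])
    show "finite P" using PI finite_index finite_subset by blast
    show "v \<in> carrier (vs U) \<Longrightarrow> (\<And>i. i \<in> P \<Longrightarrow> x i v = \<zero>\<^bsub>K\<^esub>) \<Longrightarrow> v = \<zero>\<^bsub>vs U\<^esub>" for v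
      using zero[of v] by simp
  qed (use f PI in \<open>auto simp: dual_def Ucl x_closed x_add x_smult\<close>)
  then show ?thesis using PT that by blast
qed

lemma subdim_le_card:
  assumes U: "VectorSpace.subspace K U V" and T: "T \<subseteq> I"
    and sep: "\<And>v. \<lbrakk>v \<in> U; \<And>t. t \<in> T \<Longrightarrow> x t v = \<zero>\<^bsub>K\<^esub>\<rbrakk> \<Longrightarrow> v = \<zero>\<^bsub>V\<^esub>"
  shows "subdim K V U \<le> card T"
proof -
  obtain P f where P: "P \<subseteq> T" "coordinates K (vs U) P f x"
    using pivots[OF assms] by blast
  then have "subdim K V U = card P"
    unfolding subdim_def by (simp add: coordinates.dim_eq_card)
  also have "\<dots> \<le> card T"
    using P T finite_index by (meson card_mono finite_subset)
  finally show ?thesis .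
qed

end

section \<open>Expansion of graphs and of linear pairings\<close>

context coordinates
begin

lemma finsum_subspace:
  assumes U: "VectorSpace.subspace K U V" and g: "g \<in> A \<rightarrow> U"
  shows "finsum (vs U) g A = finsum V g A"
    and "finsum V g A \<in> U"
proof -
  interpret U: vectorspace K "vs U" by (rule subspace_is_vs[OF U])
  have "g \<in> A \<rightarrow> U \<Longrightarrow> finsum (vs U) g A = finsum V g A"
  proof (induction A rule: infinite_finite_induct)
    case (infinite A)
    then show ?case by (simp add: finsum_def finprod_def)
  next
    case (insert a A)
    then have "g \<in> A \<rightarrow> U" "g a \<in> U" "g \<in> A \<rightarrow> carrier V" "g a \<in> carrier V"
      using subspace_closed(1)[OF U] by auto
    with insert show ?case
      by (simp add: M.finsum_insert U.M.finsum_insert)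
  qed simp
  with g show eq: "finsum (vs U) g A = finsum V g A" by blast
  show "finsum V g A \<in> U"
    using U.M.finsum_closed[of g A] g eq by simp
qed

text \<open>The bound \<open>dim (F + C) \<le> card I - card D\<close> when the vectors of \<open>C\<close>, reduced modulo \<open>F\<close> so as to
  vanish on the pivots \<open>P\<close>, also vanish on \<open>D\<close>. The reduction \<open>y \<mapsto> y - \<Sum>p\<in>P. x p y \<cdot> f p\<close>,
  restricted to \<open>C\<close>, has kernel \<open>C \<inter> F\<close>, and its image embeds in the coordinates outside
  \<open>P \<union> D\<close>; rank and nullity do the rest.\<close>

lemma dim_subspace_plus:
  assumes F: "VectorSpace.subspace K F V" and C: "VectorSpace.subspace K C V"
    and P: "P \<subseteq> I" and f: "coordinates K (vs F) P f x" and D: "D \<subseteq> I - P"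
    and vanish: "\<And>y w. \<lbrakk>y \<in> C; w \<in> D\<rbrakk> \<Longrightarrow> x w y = (\<Oplus>\<^bsub>K\<^esub>p\<in>P. x p y \<otimes>\<^bsub>K\<^esub> x w (f p))"
  shows "subdim K V C + card P + card D \<le> card I + subdim K V (C \<inter> F)"
proof -
  interpret F: coordinates K "vs F" P f x by (rule f)
  note Fcl = subspace_closed[OF F] and Ccl = subspace_closed[OF C]
  have fF: "f p \<in> F" "f p \<in> carrier V" if "p \<in> P" for p
    using F.e_closed[OF that] Fcl(1) by auto
  define proj where "proj y = (\<Oplus>\<^bsub>V\<^esub>p\<in>P. x p y \<odot>\<^bsub>V\<^esub> f p)" for y
  have summand: "(\<lambda>p. x p y \<odot>\<^bsub>V\<^esub> f p) \<in> P \<rightarrow> carrier V" if "y \<in> carrier V" for y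
    using that fF P x_closed by auto
  have proj_F: "proj y \<in> F" if "y \<in> carrier V" for y
    unfolding proj_def using that fF P x_closed Fcl(4) by (intro finsum_subspace(2)[OF F]) auto
  have proj_V: "proj y \<in> carrier V" if "y \<in> carrier V" for y
    using proj_F[OF that] Fcl(1) by blast
  have proj_id: "proj y = y" if "y \<in> F" for y
    unfolding proj_def using F.expansion[of y] that fF P x_closed Fcl
    by (subst finsum_subspace(1)[OF F, symmetric]) auto
  have x_proj: "x i (proj y) = (\<Oplus>\<^bsub>K\<^esub>p\<in>P. x p y \<otimes>\<^bsub>K\<^esub> x i (f p))"
    if "i \<in> I" "y \<in> carrier V" for i y
  proof -
    have "x i (proj y) = (\<Oplus>\<^bsub>K\<^esub>p\<in>P. x i (x p y \<odot>\<^bsub>V\<^esub> f p))"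
      unfolding proj_def using that summand F.finite_index by (intro x_finsum) auto
    also have "\<dots> = (\<Oplus>\<^bsub>K\<^esub>p\<in>P. x p y \<otimes>\<^bsub>K\<^esub> x i (f p))"
      using that fF P x_closed by (intro R.finsum_cong') (auto simp: x_smult subset_iff)
    finally show ?thesis .
  qed
  have proj_P: "x p (proj y) = x p y" if "p \<in> P" "y \<in> carrier V" for p y
  proof -
    have "x p (proj y) = (\<Oplus>\<^bsub>K\<^esub>q\<in>P. if p = q then x q y else \<zero>\<^bsub>K\<^esub>)"
      using that P x_proj[of p y] F.x_dual x_closed
      by (auto intro!: R.finsum_cong' simp: subset_iff)
    also have "\<dots> = x p y"
      using R.finsum_singleton[of p P "\<lambda>q. x q y"] that P F.finite_index x_closed by auto
    finally show ?thesis .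
  qed
  define T where "T y = y \<ominus>\<^bsub>V\<^esub> proj y" for y
  have proj_add: "proj (y \<oplus>\<^bsub>V\<^esub> z) = proj y \<oplus>\<^bsub>V\<^esub> proj z" if "y \<in> carrier V" "z \<in> carrier V" for y z
  proof -
    have "proj (y \<oplus>\<^bsub>V\<^esub> z) = (\<Oplus>\<^bsub>V\<^esub>p\<in>P. x p y \<odot>\<^bsub>V\<^esub> f p \<oplus>\<^bsub>V\<^esub> x p z \<odot>\<^bsub>V\<^esub> f p)"
      unfolding proj_def using that fF P x_closed
      by (intro M.finsum_cong') (auto simp: x_add smult_l_distr subset_iff)
    then show ?thesis
      unfolding proj_def using M.finsum_addf[OF summand summand] that by simp
  qed
  have proj_smult: "proj (c \<odot>\<^bsub>V\<^esub> y) = c \<odot>\<^bsub>V\<^esub> proj y" if "c \<in> carrier K" "y \<in> carrier V" for c y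
  proof -
    have "proj (c \<odot>\<^bsub>V\<^esub> y) = (\<Oplus>\<^bsub>V\<^esub>p\<in>P. c \<odot>\<^bsub>V\<^esub> (x p y \<odot>\<^bsub>V\<^esub> f p))"
      unfolding proj_def using that fF P x_closed
      by (intro M.finsum_cong') (auto simp: x_smult smult_assoc1 subset_iff)
    then show ?thesis
      unfolding proj_def using finsum_smult[OF that(1) summand] that by simp
  qed
  have T_V: "T y \<in> carrier V" if "y \<in> carrier V" for y
    using that proj_V by (simp add: T_def)
  interpret T: linear_map K "vs C" V T
  proof (intro linear_map.intro mod_hom.intro mod_hom_axioms.intro)
    show "vectorspace K (vs C)" by (rule subspace_is_vs[OF C])
    then show "Module.module K (vs C)" by (simp add: vectorspace_def)
    show "vectorspace K V" "Module.module K V" by unfold_locales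
    have "T (y \<oplus>\<^bsub>V\<^esub> z) = T y \<oplus>\<^bsub>V\<^esub> T z" if "y \<in> carrier V" "z \<in> carrier V" for y z
      using that proj_V by (simp add: T_def proj_add M.minus_eq M.minus_add M.a_ac)
    moreover have "T (c \<odot>\<^bsub>V\<^esub> y) = c \<odot>\<^bsub>V\<^esub> T y" if "c \<in> carrier K" "y \<in> carrier V" for c y
      using that proj_V by (simp add: T_def proj_smult M.minus_eq smult_r_distr smult_r_minus)
    ultimately show "T \<in> LinearCombinations.module_hom K (vs C) V"
      unfolding LinearCombinations.module_hom_def using Ccl(1) T_V by auto
  qed
  obtain PC fC where "coordinates K (vs C) PC fC x"
    using pivots[OF C subset_refl] Ccl(1) x_separates by metis
  then have fd: "T.V.fin_dim" by (rule coordinates.fin_dim)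
  have ker: "T.kerT = C \<inter> F"
  proof -
    have "T y = \<zero>\<^bsub>V\<^esub> \<longleftrightarrow> y \<in> F" if "y \<in> C" for y
      using that Ccl(1) proj_V proj_F proj_id M.minus_other_side[of y "proj y"]
      unfolding T_def by metis
    then show ?thesis unfolding T.ker_def by auto
  qed
  have im: "subdim K V T.imT \<le> card (I - P - D)"
  proof (rule subdim_le_card[OF T.imT_is_subspace])
    fix v assume "v \<in> T.imT" and 0: "\<And>t. t \<in> I - P - D \<Longrightarrow> x t v = \<zero>\<^bsub>K\<^esub>"
    then obtain y where y: "y \<in> C" "v = T y" unfolding T.im_def by auto
    then have yV: "y \<in> carrier V" using Ccl by blast
    have xT: "x i v = x i y \<ominus>\<^bsub>K\<^esub> x i (proj y)" if "i \<in> I" for i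
      using that y yV proj_V by (simp add: T_def x_minus)
    have "x i v = \<zero>\<^bsub>K\<^esub>" if i: "i \<in> I" for i
    proof -
      consider "i \<in> P" | "i \<in> D" | "i \<in> I - P - D" using i by blast
      then show ?thesis
      proof cases
        case 1
        then show ?thesis using xT[OF i] proj_P[OF 1 yV] x_closed[OF i yV] by simp
      next
        case 2
        then show ?thesis
          using xT[OF i] x_proj[OF i yV] vanish[OF y(1) 2] x_closed[OF i yV] by simp
      qed (rule 0)
    qed
    then show "v = \<zero>\<^bsub>V\<^esub>" using y(2) T_V[OF yV] by (intro x_separates) auto
  qed auto
  have "card (I - P - D) + card P + card D = card I"
    using P D finite_index
    by (metis Diff_subset Un_Diff_cancel add.commute add.left_commute card_Diff_subset
        card_mono finite_Diff finite_subset le_add_diff_inverse2 subset_trans)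
  moreover have "subdim K V T.imT + subdim K V (C \<inter> F) = subdim K V C"
    using T.rank_nullity[OF fd] ker by (simp add: subdim_def)
  ultimately show ?thesis using im by linarith
qed

text \<open>Let \<open>P\<close> be the pivots of \<open>F\<close>, with echelon basis \<open>f\<close>, let \<open>\<partial>P\<close> be the vertex boundary of
  \<open>P\<close> (called \<open>B\<close> in the proof), and let \<open>S\<close> be the set of those pivots at which some vector of
  \<open>C\<close> is nonzero. The determinant condition on an edge \<open>{p, w}\<close> with \<open>p \<in> P\<close>, applied to the basis
  vectors, has three consequences. No edge joins \<open>S\<close> to \<open>P\<close>, so the neighbours of \<open>S\<close> are exactly
  its boundary \<open>\<partial>S\<close>. The value of \<open>y \<in> C\<close> at a vertex of \<open>\<partial>P\<close> is determined by its value at a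
  pivot, so \<open>C\<close> embeds in the coordinates \<open>S\<close> and those outside \<open>P \<union> \<partial>P\<close>. A vector of \<open>C\<close>
  reduced modulo \<open>F\<close> vanishes on \<open>\<partial>S\<close>. The last two facts bound the codimension \<open>m\<close> of
  \<open>F + C\<close> from below by \<open>card \<partial>P - card S\<close> and by \<open>card \<partial>S\<close>, hence by \<open>\<epsilon> \<cdot> card P - card S\<close>
  and by \<open>\<epsilon> \<cdot> card S\<close>. The first bound is useful when \<open>S\<close> is small, the second when \<open>S\<close> is
  large; adding \<open>\<epsilon>\<close> times the first to the second eliminates \<open>S\<close> and leaves
  \<open>\<epsilon>\<^sup>2 \<cdot> card P \<le> (1 + \<epsilon>) \<cdot> m\<close>.\<close>

theorem expansion_of_pairing:
  fixes \<Gamma> :: "'i sgraph" and \<epsilon> :: real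
  assumes simplicial: "fin_simplicial \<Gamma>" and verts: "verts \<Gamma> = I"
    and \<epsilon>: "0 < \<epsilon>"
    and expand: "\<And>A. \<lbrakk>A \<subseteq> I; A \<noteq> {}; 2 * card A \<le> card I\<rbrakk>
      \<Longrightarrow> \<epsilon> * card A \<le> card (vertex_boundary \<Gamma> A)"
    and F: "VectorSpace.subspace K F V" and C: "VectorSpace.subspace K C V"
    and comm: "\<And>f y v w. \<lbrakk>f \<in> F; y \<in> C; {v, w} \<in> edges \<Gamma>\<rbrakk>
      \<Longrightarrow> x v f \<otimes>\<^bsub>K\<^esub> x w y = x w f \<otimes>\<^bsub>K\<^esub> x v y"
    and half: "2 * subdim K V F \<le> dim"
  shows "\<epsilon>\<^sup>2 / (1 + \<epsilon>) * subdim K V F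
    \<le> real dim - subdim K V F - subdim K V C + subdim K V (C \<inter> F)"
proof -
  note Fcl = subspace_closed[OF F] and Ccl = subspace_closed[OF C]
  obtain P f where P: "P \<subseteq> I" and f: "coordinates K (vs F) P f x"
    using pivots[OF F subset_refl] Fcl(1) x_separates by metis
  interpret F: coordinates K "vs F" P f x by (rule f)
  have dimF: "subdim K V F = card P" unfolding subdim_def by (rule F.dim_eq_card)
  have fF: "f p \<in> F" "f p \<in> carrier V" if "p \<in> P" for p
    using F.e_closed[OF that] Fcl(1) by auto
  have edge: "v \<in> I \<and> w \<in> I \<and> v \<noteq> w" if "{v, w} \<in> edges \<Gamma>" for v w
    using that simplicial verts unfolding fin_simplicial_def by (auto simp: doubleton_eq_iff)
  have fin: "finite P" using P finite_index finite_subset by blast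
  define S where "S = {p \<in> P. \<exists>y\<in>C. x p y \<noteq> \<zero>\<^bsub>K\<^esub>}"
  define N where "N = vertex_boundary \<Gamma> S"
  define B where "B = vertex_boundary \<Gamma> P"
  have SP: "S \<subseteq> P" unfolding S_def by blast
  have BI: "B \<subseteq> I - P" unfolding B_def vertex_boundary_def verts by blast
  have N_off_P: "w \<notin> P" if s: "s \<in> S" and sw: "{s, w} \<in> edges \<Gamma>" for s w
  proof
    assume w: "w \<in> P"
    from s obtain y where y: "y \<in> C" "x s y \<noteq> \<zero>\<^bsub>K\<^esub>" and sP: "s \<in> P" unfolding S_def by blast
    have cl: "x s y \<in> carrier K" "x w y \<in> carrier K" using edge[OF sw] y Ccl(1) x_closed by auto
    have "x s (f w) \<otimes>\<^bsub>K\<^esub> x w y = x w (f w) \<otimes>\<^bsub>K\<^esub> x s y" using comm fF(1)[OF w] y sw by blast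
    then show False using F.x_dual[OF sP w] F.x_dual[OF w w] edge[OF sw] cl y by simp
  qed
  have NI: "N \<subseteq> I - P"
    using N_off_P unfolding N_def vertex_boundary_def verts by blast
  have bound1: "subdim K V C \<le> card (S \<union> (I - P - B))"
  proof (rule subdim_le_card[OF C])
    show "S \<union> (I - P - B) \<subseteq> I" using SP P by blast
    fix y assume y: "y \<in> C" and 0: "\<And>t. t \<in> S \<union> (I - P - B) \<Longrightarrow> x t y = \<zero>\<^bsub>K\<^esub>"
    have yP: "x p y = \<zero>\<^bsub>K\<^esub>" if "p \<in> P" for p using that y 0[of p] unfolding S_def by blast
    have yB: "x w y = \<zero>\<^bsub>K\<^esub>" if "w \<in> B" for w
    proof -
      from that obtain p where p: "p \<in> P" "{p, w} \<in> edges \<Gamma>"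
        unfolding B_def vertex_boundary_def by blast
      have "x p (f p) \<otimes>\<^bsub>K\<^esub> x w y = x w (f p) \<otimes>\<^bsub>K\<^esub> x p y" using comm fF(1)[OF p(1)] y p(2) by blast
      then show ?thesis
        using F.x_dual[OF p(1) p(1)] yP[OF p(1)] edge[OF p(2)] y Ccl(1) x_closed fF[OF p(1)] by simp
    qed
    show "y = \<zero>\<^bsub>V\<^esub>" using y Ccl(1) 0 yP yB by (intro x_separates) blast+
  qed
  have bound2: "subdim K V C + card P + card N \<le> card I + subdim K V (C \<inter> F)"
  proof (rule dim_subspace_plus[OF F C P f NI])
    fix y w assume y: "y \<in> C" and w: "w \<in> N"
    from w obtain s where s: "s \<in> S" "{s, w} \<in> edges \<Gamma>" unfolding N_def vertex_boundary_def by blast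
    have sP: "s \<in> P" using s SP by blast
    have wI: "w \<in> I" and sI: "s \<in> I" using edge[OF s(2)] by auto
    have yV: "y \<in> carrier V" using y Ccl by blast
    from s obtain z where z: "z \<in> C" "x s z \<noteq> \<zero>\<^bsub>K\<^esub>" unfolding S_def by blast
    have "x w (f p) = \<zero>\<^bsub>K\<^esub>" if p: "p \<in> P" "p \<noteq> s" for p
    proof -
      have "x s (f p) \<otimes>\<^bsub>K\<^esub> x w z = x w (f p) \<otimes>\<^bsub>K\<^esub> x s z"
        using comm fF(1)[OF p(1)] z s(2) by blast
      moreover have "x s (f p) = \<zero>\<^bsub>K\<^esub>" using F.x_dual[OF sP p(1)] p(2) by simp
      moreover have "x w z \<in> carrier K" "x s z \<in> carrier K" "x w (f p) \<in> carrier K"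
        using wI sI z Ccl(1) x_closed fF[OF p(1)] by auto
      ultimately show ?thesis using z(2) integral_iff by fastforce
    qed
    then have "(\<Oplus>\<^bsub>K\<^esub>p\<in>P. x p y \<otimes>\<^bsub>K\<^esub> x w (f p))
        = (\<Oplus>\<^bsub>K\<^esub>p\<in>P. if s = p then x p y \<otimes>\<^bsub>K\<^esub> x w (f p) else \<zero>\<^bsub>K\<^esub>)"
      using yV wI P fF x_closed by (intro R.finsum_cong') (auto simp: subset_iff)
    also have "\<dots> = x s y \<otimes>\<^bsub>K\<^esub> x w (f s)"
      using yV wI P fF x_closed sP fin
      by (intro R.finsum_singleton) auto
    also have "\<dots> = x s (f s) \<otimes>\<^bsub>K\<^esub> x w y"
      using comm[OF fF(1)[OF sP] y s(2)] yV wI sI fF[OF sP] x_closed by (simp add: R.m_comm)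
    also have "\<dots> = x w y" using F.x_dual[OF sP sP] yV wI x_closed by simp
    finally show "x w y = (\<Oplus>\<^bsub>K\<^esub>p\<in>P. x p y \<otimes>\<^bsub>K\<^esub> x w (f p))" by simp
  qed
  have n: "dim = card I" by (rule dim_eq_card)
  have eB: "\<epsilon> * card P \<le> card B"
    using expand[OF P] half n dimF unfolding B_def by (cases "P = {}") auto
  have "card S \<le> card P" using SP fin card_mono by blast
  then have eN: "\<epsilon> * card S \<le> card N"
    using expand[of S] SP P half n dimF unfolding N_def by (cases "S = {}") auto
  have "card (S \<union> (I - P - B)) \<le> card S + card (I - P - B)" by (rule card_Un_le)
  moreover have "card (I - P - B) + card P + card B = card I"
  proof -
    have "card (I - P - B) = card (I - P) - card B" "card (I - P) = card I - card P"
      using BI P finite_index by (meson card_Diff_subset finite_Diff finite_subset)+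
    moreover have "card B \<le> card (I - P)" "card P \<le> card I"
      using BI P finite_index by (auto intro: card_mono)
    ultimately show ?thesis by linarith
  qed
  ultimately have b1: "real (subdim K V C) + card P + card B \<le> card S + card I"
    using bound1 by linarith
  define m where "m = real dim - subdim K V F - subdim K V C + subdim K V (C \<inter> F)"
  have m1: "\<epsilon> * card P - card S \<le> m" using b1 eB n dimF unfolding m_def by linarith
  have m2: "\<epsilon> * card S \<le> m" using bound2 eN n dimF unfolding m_def by linarith
  have "\<epsilon> * (\<epsilon> * card P - card S) + \<epsilon> * card S \<le> \<epsilon> * m + m"
    using m1 m2 \<epsilon> by (intro add_mono mult_left_mono) auto
  then have "\<epsilon>\<^sup>2 * card P \<le> (1 + \<epsilon>) * m" by (simp add: algebra_simps power2_eq_square)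
  then show ?thesis using \<epsilon> dimF unfolding m_def by (simp add: field_simps)
qed

end

section \<open>Presented groups and the Heisenberg group\<close>

fun word_eval :: "('g, 'b) monoid_scheme \<Rightarrow> ('s \<Rightarrow> 'g) \<Rightarrow> 's word \<Rightarrow> 'g" where
  "word_eval H \<phi> [] = \<one>\<^bsub>H\<^esub>"
| "word_eval H \<phi> ((s, b) # w) = (if b then \<phi> s else inv\<^bsub>H\<^esub> \<phi> s) \<otimes>\<^bsub>H\<^esub> word_eval H \<phi> w"

lemma words_simps [simp]:
  "[] \<in> words S" "(s, b) # w \<in> words S \<longleftrightarrow> s \<in> S \<and> w \<in> words S"
  "u @ w \<in> words S \<longleftrightarrow> u \<in> words S \<and> w \<in> words S"
  by (auto simp: words_def)

lemma (in group) word_eval_closed: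
  assumes "\<phi> \<in> S \<rightarrow> carrier G" "w \<in> words S"
  shows "word_eval G \<phi> w \<in> carrier G"
  using assms(2)
proof (induction w)
  case (Cons a w)
  moreover obtain s b where "a = (s, b)" by (cases a)
  ultimately show ?case using assms(1) by (auto simp: Pi_iff)
qed simp

lemma (in group) word_eval_append:
  assumes \<phi>: "\<phi> \<in> S \<rightarrow> carrier G" and "u \<in> words S" and w: "w \<in> words S"
  shows "word_eval G \<phi> (u @ w) = word_eval G \<phi> u \<otimes> word_eval G \<phi> w"
  using assms(2)
proof (induction u)
  case Nil
  then show ?case using word_eval_closed[OF \<phi> w] by simp
next
  case (Cons a u)
  moreover obtain s b where "a = (s, b)" by (cases a)
  ultimately show ?case
    using \<phi> word_eval_closed[OF \<phi> w] word_eval_closed[OF \<phi>, of u]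
    by (auto simp: m_assoc Pi_iff)
qed

locale group_presentation =
  fixes S :: "'s set" and R :: "'s word set"
  assumes relators: "R \<subseteq> words S"
begin

abbreviation "cls \<equiv> pres_class S R"
abbreviation "G \<equiv> pres_group S R"

lemma pres_eq_words:
  "pres_eq S R u w \<Longrightarrow> u \<in> words S \<and> w \<in> words S"
  by (induction rule: pres_eq.induct) (use relators in auto)

lemma pres_eq_append:
  assumes "pres_eq S R u u'" "pres_eq S R w w'"
  shows "pres_eq S R (u @ w) (u' @ w')"
proof -
  have left: "pres_eq S R (z @ u) (z @ u')" if "pres_eq S R u u'" "z \<in> words S" for z u u'
    using that
  proof (induction rule: pres_eq.induct)
    case (cancel x y s b)
    then show ?case using pres_eq.cancel[of "z @ x" S y s R b] by simp
  next
    case (relator x y r)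
    then show ?case using pres_eq.relator[of "z @ x" S y r R] by simp
  next
    case (refl w)
    then show ?case by (simp add: pres_eq.refl)
  next
    case (sym u w)
    show ?case by (rule pres_eq.sym[OF sym.IH[OF sym.prems]])
  next
    case (trans u v w)
    show ?case by (rule pres_eq.trans[OF trans.IH(1)[OF trans.prems] trans.IH(2)[OF trans.prems]])
  qed
  have right: "pres_eq S R (u @ z) (u' @ z)" if "pres_eq S R u u'" "z \<in> words S" for z u u'
    using that
  proof (induction rule: pres_eq.induct)
    case (cancel x y s b)
    then show ?case using pres_eq.cancel[of x S "y @ z" s R b] by simp
  next
    case (relator x y r)
    then show ?case using pres_eq.relator[of x S "y @ z" r R] by simp
  next
    case (refl w)
    then show ?case by (simp add: pres_eq.refl)
  next
    case (sym u w)
    show ?case by (rule pres_eq.sym[OF sym.IH[OF sym.prems]])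
  next
    case (trans u v w)
    show ?case by (rule pres_eq.trans[OF trans.IH(1)[OF trans.prems] trans.IH(2)[OF trans.prems]])
  qed
  have "u \<in> words S" "w' \<in> words S" using pres_eq_words assms by blast+
  then show ?thesis
    by (rule pres_eq.trans[OF left[OF assms(2)] right[OF assms(1)]])
qed

lemma cls_eq_iff:
  assumes "u \<in> words S"
  shows "cls u = cls w \<longleftrightarrow> pres_eq S R u w"
proof
  assume "cls u = cls w"
  then have "u \<in> cls w" using pres_eq.refl[OF assms] by (auto simp: pres_class_def)
  then have "pres_eq S R w u" by (simp add: pres_class_def)
  then show "pres_eq S R u w" by (rule pres_eq.sym)
next
  assume uw: "pres_eq S R u w"
  have "pres_eq S R u z \<longleftrightarrow> pres_eq S R w z" for z
    using uw pres_eq.trans[of S R u w z] pres_eq.trans[OF pres_eq.sym[OF uw], of z] by blast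
  then show "cls u = cls w" unfolding pres_class_def by blast
qed

lemma cls_in_carrier: "w \<in> words S \<Longrightarrow> cls w \<in> carrier G"
  by (simp add: pres_group_def)

lemma carrierE:
  assumes "X \<in> carrier G"
  obtains w where "w \<in> words S" "X = cls w"
  using assms by (auto simp: pres_group_def)

lemma one_cls: "\<one>\<^bsub>G\<^esub> = cls []"
  by (simp add: pres_group_def)

lemma mult_cls:
  assumes "u \<in> words S" "w \<in> words S"
  shows "cls u \<otimes>\<^bsub>G\<^esub> cls w = cls (u @ w)"
proof -
  have eq: "cls (u' @ w') = cls (u @ w)" if "u' \<in> cls u" "w' \<in> cls w" for u' w'
  proof -
    have "pres_eq S R (u @ w) (u' @ w')"
      using that by (intro pres_eq_append) (simp_all add: pres_class_def)
    then have "cls (u @ w) = cls (u' @ w')" using assms cls_eq_iff[of "u @ w"] by simp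
    then show ?thesis by simp
  qed
  have mem: "u \<in> cls u" "w \<in> cls w"
    using assms by (simp_all add: pres_class_def pres_eq.refl)
  have "(\<Union>u'\<in>cls u. \<Union>w'\<in>cls w. cls (u' @ w')) = (\<Union>u'\<in>cls u. \<Union>w'\<in>cls w. cls (u @ w))"
    by (intro SUP_cong HOL.refl eq)
  also have "\<dots> = cls (u @ w)" using mem by blast
  finally have "(\<Union>u'\<in>cls u. \<Union>w'\<in>cls w. cls (u' @ w')) = cls (u @ w)" .
  then show ?thesis by (simp add: pres_group_def)
qed

lemma monoid_pres_group: "monoid G"
proof (rule monoidI)
  fix X Y Z assume XYZ: "X \<in> carrier G" "Y \<in> carrier G" "Z \<in> carrier G"
  obtain u where u: "u \<in> words S" "X = cls u" using XYZ(1) by (rule carrierE)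
  obtain v where v: "v \<in> words S" "Y = cls v" using XYZ(2) by (rule carrierE)
  obtain w where w: "w \<in> words S" "Z = cls w" using XYZ(3) by (rule carrierE)
  from u v w show "X \<otimes>\<^bsub>G\<^esub> Y \<in> carrier G" "(X \<otimes>\<^bsub>G\<^esub> Y) \<otimes>\<^bsub>G\<^esub> Z = X \<otimes>\<^bsub>G\<^esub> (Y \<otimes>\<^bsub>G\<^esub> Z)"
    "\<one>\<^bsub>G\<^esub> \<otimes>\<^bsub>G\<^esub> X = X" "X \<otimes>\<^bsub>G\<^esub> \<one>\<^bsub>G\<^esub> = X"
    by (simp_all add: mult_cls cls_in_carrier one_cls)
qed (simp add: one_cls cls_in_carrier)

lemma hom_cls:
  assumes H: "group H" and h: "h \<in> hom G H" and w: "w \<in> words S"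
  shows "h (cls w) = word_eval H (\<lambda>s. h (cls [(s, True)])) w"
proof -
  interpret H: group H by fact
  have cl: "h (cls w) \<in> carrier H" if "w \<in> words S" for w
    using h cls_in_carrier[OF that] by (auto simp: hom_def)
  have mult: "h (cls (u @ w)) = h (cls u) \<otimes>\<^bsub>H\<^esub> h (cls w)" if "u \<in> words S" "w \<in> words S" for u w
    using hom_mult[OF h cls_in_carrier[OF that(1)] cls_in_carrier[OF that(2)]]
    by (simp add: mult_cls[OF that])
  have one: "h (cls []) = \<one>\<^bsub>H\<^esub>"
    using mult[of "[]" "[]"] cl[of "[]"] by (simp add: H.l_cancel_one')
  have inv: "h (cls [(s, False)]) = inv\<^bsub>H\<^esub> h (cls [(s, True)])" if s: "s \<in> S" for s
  proof -
    have "pres_eq S R [(s, False), (s, True)] []"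
      using pres_eq.cancel[of "[]" S "[]" s R False] s by simp
    then have "cls ([(s, False)] @ [(s, True)]) = cls []" using s by (simp add: cls_eq_iff)
    then have "h (cls [(s, False)]) \<otimes>\<^bsub>H\<^esub> h (cls [(s, True)]) = \<one>\<^bsub>H\<^esub>"
      using mult[of "[(s, False)]" "[(s, True)]"] s one by simp
    then show ?thesis using cl s by (simp add: H.inv_equality)
  qed
  show ?thesis using w
  proof (induction w)
    case (Cons a w)
    obtain s b where a: "a = (s, b)" by (cases a)
    have "h (cls (a # w)) = h (cls [(s, b)]) \<otimes>\<^bsub>H\<^esub> h (cls w)"
      using mult[of "[(s, b)]" w] Cons.prems a by simp
    then show ?case using Cons a inv[of s] by (cases b) simp_all
  qed (simp add: one)
qed

lemma universal_property:
  assumes H: "group H" and \<phi>: "\<phi> \<in> S \<rightarrow> carrier H"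
    and rel: "\<And>r. r \<in> R \<Longrightarrow> word_eval H \<phi> r = \<one>\<^bsub>H\<^esub>"
  obtains h where "h \<in> hom G H" "\<And>w. w \<in> words S \<Longrightarrow> h (cls w) = word_eval H \<phi> w"
proof -
  interpret H: group H by fact
  note eval = H.word_eval_closed[OF \<phi>] H.word_eval_append[OF \<phi>]
  have resp: "word_eval H \<phi> u = word_eval H \<phi> w" if "pres_eq S R u w" for u w
    using that
  proof (induction rule: pres_eq.induct)
    case (cancel x y s b)
    then have "\<phi> s \<in> carrier H" using \<phi> by auto
    then have "word_eval H \<phi> [(s, b), (s, \<not> b)] = \<one>\<^bsub>H\<^esub>" by simp
    then show ?case using cancel eval(1) eval(2)[of x "[(s, b), (s, \<not> b)] @ y"]
      eval(2)[of "[(s, b), (s, \<not> b)]" y] eval(2)[of x y] by simp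
  next
    case (relator x y r)
    then have "r \<in> words S" using relators by blast
    then show ?case using relator eval(1) eval(2)[of x "r @ y"] eval(2)[of r y] eval(2)[of x y] rel
      by simp
  qed auto
  define h where "h X = the_elem (word_eval H \<phi> ` X)" for X
  have hc: "h (cls w) = word_eval H \<phi> w" if w: "w \<in> words S" for w
  proof -
    have mem: "w \<in> cls w" using w by (simp add: pres_class_def pres_eq.refl)
    have "word_eval H \<phi> ` cls w = (\<lambda>_. word_eval H \<phi> w) ` cls w"
      by (intro image_cong HOL.refl resp[symmetric]) (simp add: pres_class_def)
    also have "\<dots> = {word_eval H \<phi> w}" using mem by blast
    finally have "word_eval H \<phi> ` cls w = {word_eval H \<phi> w}" .
    then show ?thesis by (simp add: h_def)
  qed
  have "h \<in> hom G H"
  proof (rule homI)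
    fix X Y assume XY: "X \<in> carrier G" "Y \<in> carrier G"
    obtain u where u: "u \<in> words S" "X = cls u" using XY(1) by (rule carrierE)
    obtain w where w: "w \<in> words S" "Y = cls w" using XY(2) by (rule carrierE)
    from u w show "h X \<in> carrier H" "h (X \<otimes>\<^bsub>G\<^esub> Y) = h X \<otimes>\<^bsub>H\<^esub> h Y"
      by (simp_all add: mult_cls hc eval)
  qed
  then show ?thesis using hc that by blast
qed

end

text \<open>The group of upper unitriangular \<open>3 \<times> 3\<close> matrices, with \<open>a\<close> and \<open>b\<close> next to the diagonal and
  \<open>c\<close> in the corner. In a homomorphism \<open>(p, q, r)\<close> into this group, \<open>p\<close> and \<open>q\<close> are additive and the
  coboundary of \<open>- r\<close> is the cup product of \<open>p\<close> and \<open>q\<close>. Two elements commute if and only if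
  \<open>a b' = a' b\<close>.\<close>

definition heisenberg :: "('l, 'm) ring_scheme \<Rightarrow> ('l \<times> 'l \<times> 'l) monoid" where
  "heisenberg L =
     \<lparr>carrier = carrier L \<times> carrier L \<times> carrier L,
      mult = (\<lambda>(a, b, c) (a', b', c').
        (a \<oplus>\<^bsub>L\<^esub> a', b \<oplus>\<^bsub>L\<^esub> b', c \<oplus>\<^bsub>L\<^esub> c' \<oplus>\<^bsub>L\<^esub> a \<otimes>\<^bsub>L\<^esub> b')),
      one = (\<zero>\<^bsub>L\<^esub>, \<zero>\<^bsub>L\<^esub>, \<zero>\<^bsub>L\<^esub>)\<rparr>"

lemma heisenberg_simps [simp]:
  "(a, b, c) \<in> carrier (heisenberg L) \<longleftrightarrow> a \<in> carrier L \<and> b \<in> carrier L \<and> c \<in> carrier L"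
  "(a, b, c) \<otimes>\<^bsub>heisenberg L\<^esub> (a', b', c') =
     (a \<oplus>\<^bsub>L\<^esub> a', b \<oplus>\<^bsub>L\<^esub> b', c \<oplus>\<^bsub>L\<^esub> c' \<oplus>\<^bsub>L\<^esub> a \<otimes>\<^bsub>L\<^esub> b')"
  "\<one>\<^bsub>heisenberg L\<^esub> = (\<zero>\<^bsub>L\<^esub>, \<zero>\<^bsub>L\<^esub>, \<zero>\<^bsub>L\<^esub>)"
  by (auto simp: heisenberg_def)

lemma (in cring) heisenberg_group: "group (heisenberg R)"
proof (rule groupI)
  fix X Y Z :: "'a \<times> 'a \<times> 'a"
  obtain a b c where X: "X = (a, b, c)" by (rule prod_cases3)
  obtain a' b' c' where Y: "Y = (a', b', c')" by (rule prod_cases3)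
  obtain a'' b'' c'' where Z: "Z = (a'', b'', c'')" by (rule prod_cases3)
  note eq = X Y Z
  assume "X \<in> carrier (heisenberg R)" "Y \<in> carrier (heisenberg R)"
  then show "X \<otimes>\<^bsub>heisenberg R\<^esub> Y \<in> carrier (heisenberg R)"
    by (simp add: eq)
  assume "X \<in> carrier (heisenberg R)" "Y \<in> carrier (heisenberg R)" "Z \<in> carrier (heisenberg R)"
  then have cl: "a \<in> carrier R" "b \<in> carrier R" "c \<in> carrier R" "a' \<in> carrier R" "b' \<in> carrier R"
    "c' \<in> carrier R" "a'' \<in> carrier R" "b'' \<in> carrier R" "c'' \<in> carrier R"
    by (simp_all add: eq)
  then have "c \<oplus> c' \<oplus> a \<otimes> b' \<oplus> c'' \<oplus> (a \<oplus> a') \<otimes> b'' = c \<oplus> (c' \<oplus> c'' \<oplus> a' \<otimes> b'') \<oplus> a \<otimes> (b' \<oplus> b'')"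
    by (simp add: l_distr r_distr a_ac l_minus r_neg r_neg1 r_neg2)
  then show "X \<otimes>\<^bsub>heisenberg R\<^esub> Y \<otimes>\<^bsub>heisenberg R\<^esub> Z = X \<otimes>\<^bsub>heisenberg R\<^esub> (Y \<otimes>\<^bsub>heisenberg R\<^esub> Z)"
    using cl by (simp add: eq a_assoc)
next
  fix X assume "X \<in> carrier (heisenberg R)"
  then obtain a b c where X: "X = (a, b, c)" "a \<in> carrier R" "b \<in> carrier R" "c \<in> carrier R"
    by (cases X) simp
  show "\<one>\<^bsub>heisenberg R\<^esub> \<otimes>\<^bsub>heisenberg R\<^esub> X = X" using X by simp
  have "(\<ominus> c \<oplus> a \<otimes> b) \<oplus> c \<oplus> (\<ominus> a) \<otimes> b = \<zero>" using X(2-) by (simp add: l_distr r_distr a_ac l_minus r_neg r_neg1 r_neg2)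
  then have "(\<ominus> a, \<ominus> b, \<ominus> c \<oplus> a \<otimes> b) \<otimes>\<^bsub>heisenberg R\<^esub> X = \<one>\<^bsub>heisenberg R\<^esub>"
    using X by (simp add: l_neg)
  moreover have "(\<ominus> a, \<ominus> b, \<ominus> c \<oplus> a \<otimes> b) \<in> carrier (heisenberg R)" using X by simp
  ultimately show "\<exists>Y\<in>carrier (heisenberg R). Y \<otimes>\<^bsub>heisenberg R\<^esub> X = \<one>\<^bsub>heisenberg R\<^esub>" by blast
qed simp

section \<open>Quotient vector spaces\<close>

context vectorspace
begin

lemma subspace_abelian_subgroup:
  assumes "VectorSpace.subspace K N V"
  shows "abelian_subgroup N V"
proof -
  interpret N: submodule K N V using assms by (simp add: subspace_def)
  have "subgroup N (add_monoid V)"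
  proof
    fix v assume v: "v \<in> N"
    have "\<ominus>\<^bsub>V\<^esub> v = (\<ominus>\<^bsub>K\<^esub> \<one>\<^bsub>K\<^esub>) \<odot>\<^bsub>V\<^esub> v"
      using v N.subset by (simp add: smult_minus_1 subset_iff)
    then have "\<ominus>\<^bsub>V\<^esub> v \<in> N" using v by simp
    then show "inv\<^bsub>add_monoid V\<^esub> v \<in> N" by (simp add: a_inv_def)
  qed (use N.subset in auto)
  then show ?thesis
    by (intro abelian_subgroupI3 additive_subgroupI) (auto intro: M.abelian_group_axioms)
qed

lemma quot_coset_eq_iff:
  assumes N: "VectorSpace.subspace K N V" and v: "v \<in> carrier V" and w: "w \<in> carrier V"
  shows "N +>\<^bsub>V\<^esub> v = N +>\<^bsub>V\<^esub> w \<longleftrightarrow> v \<ominus>\<^bsub>V\<^esub> w \<in> N"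
proof -
  interpret N: abelian_subgroup N V by (rule subspace_abelian_subgroup[OF N])
  have "N +>\<^bsub>V\<^esub> v = N +>\<^bsub>V\<^esub> w \<longleftrightarrow> v \<in> N +>\<^bsub>V\<^esub> w"
    using N.a_rcos_self[OF v] M.a_repr_independence[OF _ w N.a_subgroup] by metis
  also have "\<dots> \<longleftrightarrow> v \<ominus>\<^bsub>V\<^esub> w \<in> N"
    using N.a_rcos_module[OF w v] by (simp add: a_minus_def)
  finally show ?thesis .
qed

lemma quot_smult_coset:
  assumes N: "VectorSpace.subspace K N V" and c: "c \<in> carrier K" and v: "v \<in> carrier V"
  shows "(\<Union>x\<in>N +>\<^bsub>V\<^esub> v. N +>\<^bsub>V\<^esub> (c \<odot>\<^bsub>V\<^esub> x)) = N +>\<^bsub>V\<^esub> (c \<odot>\<^bsub>V\<^esub> v)"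
proof -
  interpret N: abelian_subgroup N V by (rule subspace_abelian_subgroup[OF N])
  interpret S: submodule K N V using N by (simp add: subspace_def)
  have "N +>\<^bsub>V\<^esub> (c \<odot>\<^bsub>V\<^esub> x) = N +>\<^bsub>V\<^esub> (c \<odot>\<^bsub>V\<^esub> v)" if x: "x \<in> N +>\<^bsub>V\<^esub> v" for x
  proof -
    have xV: "x \<in> carrier V" using x v S.subset by (auto simp: a_r_coset_def')
    have "x \<ominus>\<^bsub>V\<^esub> v \<in> N" using N.a_rcos_module[OF v xV] x by (simp add: a_minus_def)
    then have "c \<odot>\<^bsub>V\<^esub> (x \<ominus>\<^bsub>V\<^esub> v) \<in> N" using c by simp
    moreover have "c \<odot>\<^bsub>V\<^esub> (x \<ominus>\<^bsub>V\<^esub> v) = c \<odot>\<^bsub>V\<^esub> x \<ominus>\<^bsub>V\<^esub> c \<odot>\<^bsub>V\<^esub> v"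
      using c v xV by (simp add: a_minus_def smult_r_distr smult_r_minus)
    ultimately show ?thesis using c v xV by (simp add: quot_coset_eq_iff[OF N])
  qed
  then have "(\<Union>x\<in>N +>\<^bsub>V\<^esub> v. N +>\<^bsub>V\<^esub> (c \<odot>\<^bsub>V\<^esub> x)) = (\<Union>x\<in>N +>\<^bsub>V\<^esub> v. N +>\<^bsub>V\<^esub> (c \<odot>\<^bsub>V\<^esub> v))"
    by (intro SUP_cong HOL.refl)
  also have "\<dots> = N +>\<^bsub>V\<^esub> (c \<odot>\<^bsub>V\<^esub> v)" using N.a_rcos_self[OF v] by blast
  finally show ?thesis .
qed

lemma quot_simps:
  assumes N: "VectorSpace.subspace K N V"
  shows "carrier (quot_module V N) = (\<lambda>v. N +>\<^bsub>V\<^esub> v) ` carrier V"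
    and "\<zero>\<^bsub>quot_module V N\<^esub> = N +>\<^bsub>V\<^esub> \<zero>\<^bsub>V\<^esub>"
    and "\<lbrakk>v \<in> carrier V; w \<in> carrier V\<rbrakk> \<Longrightarrow>
      (N +>\<^bsub>V\<^esub> v) \<oplus>\<^bsub>quot_module V N\<^esub> (N +>\<^bsub>V\<^esub> w) = N +>\<^bsub>V\<^esub> (v \<oplus>\<^bsub>V\<^esub> w)"
    and "\<lbrakk>c \<in> carrier K; v \<in> carrier V\<rbrakk> \<Longrightarrow>
      c \<odot>\<^bsub>quot_module V N\<^esub> (N +>\<^bsub>V\<^esub> v) = N +>\<^bsub>V\<^esub> (c \<odot>\<^bsub>V\<^esub> v)"
proof -
  interpret N: abelian_subgroup N V by (rule subspace_abelian_subgroup[OF N])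
  show "carrier (quot_module V N) = (\<lambda>v. N +>\<^bsub>V\<^esub> v) ` carrier V"
    by (auto simp: quot_module_def A_RCOSETS_def')
  show "\<zero>\<^bsub>quot_module V N\<^esub> = N +>\<^bsub>V\<^esub> \<zero>\<^bsub>V\<^esub>"
    using N.a_subset by (simp add: quot_module_def)
  show "\<lbrakk>v \<in> carrier V; w \<in> carrier V\<rbrakk> \<Longrightarrow>
      (N +>\<^bsub>V\<^esub> v) \<oplus>\<^bsub>quot_module V N\<^esub> (N +>\<^bsub>V\<^esub> w) = N +>\<^bsub>V\<^esub> (v \<oplus>\<^bsub>V\<^esub> w)"
    by (simp add: quot_module_def N.a_rcos_sum)
  show "\<lbrakk>c \<in> carrier K; v \<in> carrier V\<rbrakk> \<Longrightarrow>
      c \<odot>\<^bsub>quot_module V N\<^esub> (N +>\<^bsub>V\<^esub> v) = N +>\<^bsub>V\<^esub> (c \<odot>\<^bsub>V\<^esub> v)"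
    using quot_smult_coset[OF N] by (simp add: quot_module_def)
qed

lemma quot_module_vectorspace:
  assumes N: "VectorSpace.subspace K N V"
  shows "vectorspace K (quot_module V N)"
proof -
  note q = quot_simps[OF N]
  have neg: "\<exists>Y\<in>carrier (quot_module V N). X \<oplus>\<^bsub>quot_module V N\<^esub> Y = \<zero>\<^bsub>quot_module V N\<^esub>"
    if "X \<in> carrier (quot_module V N)" for X
  proof -
    obtain v where v: "v \<in> carrier V" "X = N +>\<^bsub>V\<^esub> v"
      using \<open>X \<in> carrier (quot_module V N)\<close> unfolding q(1) by blast
    have "X \<oplus>\<^bsub>quot_module V N\<^esub> (N +>\<^bsub>V\<^esub> (\<ominus>\<^bsub>V\<^esub> v)) = \<zero>\<^bsub>quot_module V N\<^esub>"
      using v by (simp add: q(2,3) M.r_neg)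
    then show ?thesis using v(1) q(1) by (metis M.a_inv_closed image_eqI)
  qed
  show ?thesis
    by (rule vs_criteria)
      (use neg in \<open>auto simp: q field_axioms M.a_ac smult_l_distr smult_r_distr smult_assoc1\<close>)
qed

end

section \<open>Group cohomology in degrees one and two\<close>

locale monoid_cohomology = L: field L + G: monoid G
  for L :: "('l, 'm) ring_scheme" and G :: "('g, 'b) monoid_scheme"
begin

abbreviation "C n \<equiv> cochains L G n"
abbreviation "Z n \<equiv> cocycles L G n"
abbreviation "B n \<equiv> coboundaries L G n"
abbreviation "d n \<equiv> coboundary_map L G n"

lemma cochain_simps:
  "carrier (C n) = tuples G n \<rightarrow>\<^sub>E carrier L"
  "\<zero>\<^bsub>C n\<^esub> = (\<lambda>_\<in>tuples G n. \<zero>\<^bsub>L\<^esub>)"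
  "f \<oplus>\<^bsub>C n\<^esub> g = (\<lambda>xs\<in>tuples G n. f xs \<oplus>\<^bsub>L\<^esub> g xs)"
  "c \<odot>\<^bsub>C n\<^esub> f = (\<lambda>xs\<in>tuples G n. c \<otimes>\<^bsub>L\<^esub> f xs)"
  by (simp_all add: cochains_def L.func_space_def)

lemma vectorspace_cochains: "vectorspace L (C n)"
  unfolding vectorspace_def cochains_def
  using L.func_space_is_module L.field_axioms by blast

lemma bar_face_tuple:
  assumes "xs \<in> tuples G (Suc n)" "i \<le> Suc n"
  shows "bar_face G i xs \<in> tuples G n"
proof -
  have len: "length xs = Suc n" and sub: "set xs \<subseteq> carrier G" using assms by (auto simp: tuples_def)
  consider "i = 0" | "i = Suc n" | "0 < i" "i < Suc n" using assms(2) by linarith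
  then show ?thesis
  proof cases
    case 1
    then show ?thesis using len sub by (cases xs) (auto simp: bar_face_def tuples_def)
  next
    case 2
    then show ?thesis using len sub by (auto simp: bar_face_def tuples_def dest: in_set_butlastD)
  next
    case 3
    have "xs ! (i - 1) \<in> carrier G" "xs ! i \<in> carrier G"
      using 3 len sub by (auto simp: subset_iff)
    then show ?thesis using 3 len sub set_take_subset[of "i - 1" xs] set_drop_subset[of "i + 1" xs]
      by (auto simp: bar_face_def tuples_def)
  qed
qed

lemma face_closed:
  assumes "f \<in> carrier (C n)" "xs \<in> tuples G (Suc n)" "i \<le> Suc n"
  shows "f (bar_face G i xs) \<in> carrier L"
  using assms bar_face_tuple by (auto simp: cochain_simps)

lemma coboundary_linear: "linear_map L (C n) (C (Suc n)) (d n)"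
proof (intro linear_map.intro mod_hom.intro mod_hom_axioms.intro)
  show vs: "vectorspace L (C n)" "vectorspace L (C (Suc n))" by (rule vectorspace_cochains)+
  then show "Module.module L (C n)" "Module.module L (C (Suc n))" by (simp_all add: vectorspace_def)
  note face = face_closed
  have "d n f \<in> carrier (C (Suc n))" if "f \<in> carrier (C n)" for f
    using face[OF that] by (auto simp: coboundary_map_def cochain_simps intro!: L.finsum_closed)
  moreover have "d n (f \<oplus>\<^bsub>C n\<^esub> g) = d n f \<oplus>\<^bsub>C (Suc n)\<^esub> d n g"
    if f: "f \<in> carrier (C n)" and g: "g \<in> carrier (C n)" for f g
  proof -
    have "(\<Oplus>\<^bsub>L\<^esub>i\<in>{..Suc n}. ((\<ominus>\<^bsub>L\<^esub> \<one>\<^bsub>L\<^esub>) [^]\<^bsub>L\<^esub> i) \<otimes>\<^bsub>L\<^esub> (f \<oplus>\<^bsub>C n\<^esub> g) (bar_face G i xs))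
      = (\<Oplus>\<^bsub>L\<^esub>i\<in>{..Suc n}. ((\<ominus>\<^bsub>L\<^esub> \<one>\<^bsub>L\<^esub>) [^]\<^bsub>L\<^esub> i) \<otimes>\<^bsub>L\<^esub> f (bar_face G i xs)) \<oplus>\<^bsub>L\<^esub>
        (\<Oplus>\<^bsub>L\<^esub>i\<in>{..Suc n}. ((\<ominus>\<^bsub>L\<^esub> \<one>\<^bsub>L\<^esub>) [^]\<^bsub>L\<^esub> i) \<otimes>\<^bsub>L\<^esub> g (bar_face G i xs))"
      if xs: "xs \<in> tuples G (Suc n)" for xs
    proof -
      let ?t = "\<lambda>f i. ((\<ominus>\<^bsub>L\<^esub> \<one>\<^bsub>L\<^esub>) [^]\<^bsub>L\<^esub> (i::nat)) \<otimes>\<^bsub>L\<^esub> f (bar_face G i xs)"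
      have "(\<Oplus>\<^bsub>L\<^esub>i\<in>{..Suc n}. ?t (f \<oplus>\<^bsub>C n\<^esub> g) i) = (\<Oplus>\<^bsub>L\<^esub>i\<in>{..Suc n}. ?t f i \<oplus>\<^bsub>L\<^esub> ?t g i)"
        using face[OF f xs] face[OF g xs] bar_face_tuple[OF xs]
        by (intro L.finsum_cong') (auto simp: cochain_simps(3) L.r_distr)
      also have "\<dots> = (\<Oplus>\<^bsub>L\<^esub>i\<in>{..Suc n}. ?t f i) \<oplus>\<^bsub>L\<^esub> (\<Oplus>\<^bsub>L\<^esub>i\<in>{..Suc n}. ?t g i)"
        using face[OF f xs] face[OF g xs] by (intro L.finsum_addf) auto
      finally show ?thesis .
    qed
    then show ?thesis
      unfolding coboundary_map_def cochain_simps(3)[of "Suc n"] by (intro restrict_ext) simp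
  qed
  moreover have "d n (c \<odot>\<^bsub>C n\<^esub> f) = c \<odot>\<^bsub>C (Suc n)\<^esub> d n f"
    if c: "c \<in> carrier L" and f: "f \<in> carrier (C n)" for c f
  proof -
    have "(\<Oplus>\<^bsub>L\<^esub>i\<in>{..Suc n}. ((\<ominus>\<^bsub>L\<^esub> \<one>\<^bsub>L\<^esub>) [^]\<^bsub>L\<^esub> i) \<otimes>\<^bsub>L\<^esub> (c \<odot>\<^bsub>C n\<^esub> f) (bar_face G i xs))
      = c \<otimes>\<^bsub>L\<^esub> (\<Oplus>\<^bsub>L\<^esub>i\<in>{..Suc n}. ((\<ominus>\<^bsub>L\<^esub> \<one>\<^bsub>L\<^esub>) [^]\<^bsub>L\<^esub> i) \<otimes>\<^bsub>L\<^esub> f (bar_face G i xs))"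
      if xs: "xs \<in> tuples G (Suc n)" for xs
      using face[OF f xs] bar_face_tuple[OF xs] c
      by (subst L.finsum_rdistr)
        (auto intro!: L.finsum_cong' simp: cochain_simps(4) L.m_lcomm simp del: L.finsum_Suc)
    then show ?thesis
      unfolding coboundary_map_def cochain_simps(4)[of "Suc n"] by (intro restrict_ext) simp
  qed
  ultimately show "d n \<in> LinearCombinations.module_hom L (C n) (C (Suc n))"
    unfolding LinearCombinations.module_hom_def by auto
qed

lemma subspace_cocycles: "VectorSpace.subspace L (Z n) (C n)"
proof -
  interpret d: linear_map L "C n" "C (Suc n)" "d n" by (rule coboundary_linear)
  have "Z n = d.kerT" unfolding cocycles_def d.ker_def by auto
  then show ?thesis using d.kerT_is_subspace by simp
qed

lemma subspace_coboundaries: "VectorSpace.subspace L (B (Suc n)) (C (Suc n))"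
proof -
  interpret d: linear_map L "C n" "C (Suc n)" "d n" by (rule coboundary_linear)
  have "B (Suc n) = d.imT" unfolding coboundaries_def d.im_def by simp
  then show ?thesis using d.imT_is_subspace by simp
qed

lemma tuples_0: "tuples G 0 = {[]}"
  by (auto simp: tuples_def)

lemma tuples_Suc: "tuples G (Suc n) = {x # xs | x xs. x \<in> carrier G \<and> xs \<in> tuples G n}"
  by (auto simp: tuples_def length_Suc_conv)

lemma tuples_1: "tuples G 1 = {[x] | x. x \<in> carrier G}"
  and tuples_2: "tuples G 2 = {[x, y] | x y. x \<in> carrier G \<and> y \<in> carrier G}"
  and tuples_3: "tuples G 3 = {[x, y, z] | x y z. x \<in> carrier G \<and> y \<in> carrier G \<and> z \<in> carrier G}"
  by (auto simp: tuples_0 tuples_Suc numeral_2_eq_2 numeral_3_eq_3)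

lemma coboundary_0:
  assumes "f \<in> carrier (C 0)" "x \<in> carrier G"
  shows "d 0 f [x] = \<zero>\<^bsub>L\<^esub>"
proof -
  have "f [] \<in> carrier L" using assms by (auto simp: cochain_simps tuples_0)
  then show ?thesis
    using assms by (simp add: coboundary_map_def tuples_Suc tuples_0 bar_face_def L.l_minus L.l_neg)
qed

lemma coboundary_1:
  assumes f: "f \<in> carrier (C 1)" and x: "x \<in> carrier G" "y \<in> carrier G"
  shows "d 1 f [x, y] = f [y] \<ominus>\<^bsub>L\<^esub> f [x \<otimes>\<^bsub>G\<^esub> y] \<oplus>\<^bsub>L\<^esub> f [x]"
proof -
  have cl: "f [x] \<in> carrier L" "f [y] \<in> carrier L" "f [x \<otimes>\<^bsub>G\<^esub> y] \<in> carrier L"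
    using assms by (auto simp: cochain_simps tuples_def PiE_iff)
  define t where "t i = ((\<ominus>\<^bsub>L\<^esub> \<one>\<^bsub>L\<^esub>) [^]\<^bsub>L\<^esub> i) \<otimes>\<^bsub>L\<^esub> f (bar_face G i [x, y])" for i :: nat
  have t: "t 0 = f [y]" "t 1 = \<ominus>\<^bsub>L\<^esub> f [x \<otimes>\<^bsub>G\<^esub> y]" "t 2 = f [x]"
    using cl by (simp_all add: t_def bar_face_def numeral_2_eq_2 L.l_minus)
  have "[x, y] \<in> tuples G (Suc 1)" using x by (simp add: tuples_def)
  then have tcl: "t i \<in> carrier L" if "i \<le> Suc 1" for i
    using face_closed[OF f, of _ i] that by (simp add: t_def)
  from \<open>_ \<in> tuples G (Suc 1)\<close> have "d 1 f [x, y] = (\<Oplus>\<^bsub>L\<^esub>i\<in>{..Suc 1}. t i)" by (simp add: coboundary_map_def t_def)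
  also have "\<dots> = t 2 \<oplus>\<^bsub>L\<^esub> (t 1 \<oplus>\<^bsub>L\<^esub> t 0)"
    using tcl by (simp add: numeral_2_eq_2 Pi_iff)
  finally show ?thesis using cl unfolding t by (simp add: L.minus_eq L.a_ac)
qed

lemma coboundary_2:
  assumes f: "f \<in> carrier (C 2)" and x: "x \<in> carrier G" "y \<in> carrier G" "z \<in> carrier G"
  shows "d 2 f [x, y, z] =
    f [y, z] \<ominus>\<^bsub>L\<^esub> f [x \<otimes>\<^bsub>G\<^esub> y, z] \<oplus>\<^bsub>L\<^esub> f [x, y \<otimes>\<^bsub>G\<^esub> z] \<ominus>\<^bsub>L\<^esub> f [x, y]"
proof -
  have cl: "f [y, z] \<in> carrier L" "f [x \<otimes>\<^bsub>G\<^esub> y, z] \<in> carrier L" "f [x, y \<otimes>\<^bsub>G\<^esub> z] \<in> carrier L"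
    "f [x, y] \<in> carrier L"
    using assms by (auto simp: cochain_simps tuples_def PiE_iff)
  define t where "t i = ((\<ominus>\<^bsub>L\<^esub> \<one>\<^bsub>L\<^esub>) [^]\<^bsub>L\<^esub> i) \<otimes>\<^bsub>L\<^esub> f (bar_face G i [x, y, z])" for i :: nat
  have t: "t 0 = f [y, z]" "t 1 = \<ominus>\<^bsub>L\<^esub> f [x \<otimes>\<^bsub>G\<^esub> y, z]" "t 2 = f [x, y \<otimes>\<^bsub>G\<^esub> z]"
    "t 3 = \<ominus>\<^bsub>L\<^esub> f [x, y]"
    using cl by (simp_all add: t_def bar_face_def numeral_2_eq_2 numeral_3_eq_3 L.l_minus)
  have "[x, y, z] \<in> tuples G (Suc 2)" using x by (simp add: tuples_def)
  then have tcl: "t i \<in> carrier L" if "i \<le> Suc 2" for i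
    using face_closed[OF f, of _ i] that by (simp add: t_def)
  from \<open>_ \<in> tuples G (Suc 2)\<close> have "d 2 f [x, y, z] = (\<Oplus>\<^bsub>L\<^esub>i\<in>{..Suc 2}. t i)" by (simp add: coboundary_map_def t_def)
  also have "\<dots> = t 3 \<oplus>\<^bsub>L\<^esub> (t 2 \<oplus>\<^bsub>L\<^esub> (t 1 \<oplus>\<^bsub>L\<^esub> t 0))"
    using tcl by (simp add: numeral_2_eq_2 numeral_3_eq_3 Pi_iff)
  finally show ?thesis using cl unfolding t by (simp add: L.minus_eq L.a_ac)
qed

(* Degree one stays the numeral 1, in which the statements below are written. *)
declare One_nat_def [simp del]

abbreviation "H n \<equiv> cohomology L G n"

lemma cochain_1_closed: "\<lbrakk>f \<in> carrier (C 1); x \<in> carrier G\<rbrakk> \<Longrightarrow> f [x] \<in> carrier L"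
  by (auto simp: cochain_simps tuples_def PiE_iff)

lemma cochain_eqI:
  assumes "f \<in> carrier (C n)" "g \<in> carrier (C n)" "\<And>xs. xs \<in> tuples G n \<Longrightarrow> f xs = g xs"
  shows "f = g"
  using assms unfolding cochain_simps by (rule PiE_ext)

lemma coboundaries_1: "B 1 = {\<zero>\<^bsub>C 1\<^esub>}"
proof -
  interpret d: linear_map L "C 0" "C 1" "d 0" using coboundary_linear[of 0] by (simp add: One_nat_def)
  have zero: "d 0 f = \<zero>\<^bsub>C 1\<^esub>" if f: "f \<in> carrier (C 0)" for f
  proof (rule cochain_eqI[of _ 1])
    show "d 0 f xs = \<zero>\<^bsub>C 1\<^esub> xs" if "xs \<in> tuples G 1" for xs
      using that coboundary_0[OF f] by (auto simp: cochain_simps tuples_1)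
  qed (use f in simp_all)
  have "d 0 ` carrier (C 0) = (\<lambda>_. \<zero>\<^bsub>C 1\<^esub>) ` carrier (C 0)"
    by (rule image_cong[OF HOL.refl zero])
  also have "\<dots> = {\<zero>\<^bsub>C 1\<^esub>}"
    by (rule image_constant[of "\<zero>\<^bsub>C 0\<^esub>"]) simp
  finally show ?thesis unfolding coboundaries_def by simp
qed

lemma cocycle_1_iff:
  assumes f: "f \<in> carrier (C 1)"
  shows "f \<in> Z 1 \<longleftrightarrow> (\<forall>x\<in>carrier G. \<forall>y\<in>carrier G. f [x \<otimes>\<^bsub>G\<^esub> y] = f [x] \<oplus>\<^bsub>L\<^esub> f [y])"
proof -
  interpret d: linear_map L "C 1" "C 2" "d 1"
    using coboundary_linear[of 1] by (simp add: numeral_2_eq_2 One_nat_def)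
  have "d 1 f = \<zero>\<^bsub>C 2\<^esub> \<longleftrightarrow> (\<forall>x\<in>carrier G. \<forall>y\<in>carrier G. d 1 f [x, y] = \<zero>\<^bsub>L\<^esub>)"
  proof
    assume "d 1 f = \<zero>\<^bsub>C 2\<^esub>"
    then show "\<forall>x\<in>carrier G. \<forall>y\<in>carrier G. d 1 f [x, y] = \<zero>\<^bsub>L\<^esub>"
      by (simp add: cochain_simps tuples_def)
  next
    assume *: "\<forall>x\<in>carrier G. \<forall>y\<in>carrier G. d 1 f [x, y] = \<zero>\<^bsub>L\<^esub>"
    show "d 1 f = \<zero>\<^bsub>C 2\<^esub>"
    proof (rule cochain_eqI[of _ 2])
      show "d 1 f xs = \<zero>\<^bsub>C 2\<^esub> xs" if "xs \<in> tuples G 2" for xs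
        using that * by (auto simp: cochain_simps tuples_2)
    qed (use f in simp_all)
  qed
  moreover have "d 1 f [x, y] = \<zero>\<^bsub>L\<^esub> \<longleftrightarrow> f [x \<otimes>\<^bsub>G\<^esub> y] = f [x] \<oplus>\<^bsub>L\<^esub> f [y]"
    if "x \<in> carrier G" "y \<in> carrier G" for x y
  proof -
    have cl: "f [x] \<in> carrier L" "f [y] \<in> carrier L" "f [x \<otimes>\<^bsub>G\<^esub> y] \<in> carrier L"
      using f that cochain_1_closed by auto
    have "d 1 f [x, y] = (f [x] \<oplus>\<^bsub>L\<^esub> f [y]) \<ominus>\<^bsub>L\<^esub> f [x \<otimes>\<^bsub>G\<^esub> y]"
      using coboundary_1[OF f that] cl by (simp add: L.minus_eq L.a_ac)
    then show ?thesis using cl by auto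
  qed
  ultimately show ?thesis using f unfolding cocycles_def by (simp add: Suc_1)
qed

lemma cocycle_1_closed: "f \<in> Z 1 \<Longrightarrow> f \<in> carrier (C 1)"
  by (simp add: cocycles_def)

lemma cocycle_2I:
  assumes f: "f \<in> carrier (C 2)"
    and "\<And>x y z. \<lbrakk>x \<in> carrier G; y \<in> carrier G; z \<in> carrier G\<rbrakk> \<Longrightarrow>
      f [y, z] \<ominus>\<^bsub>L\<^esub> f [x \<otimes>\<^bsub>G\<^esub> y, z] \<oplus>\<^bsub>L\<^esub> f [x, y \<otimes>\<^bsub>G\<^esub> z] \<ominus>\<^bsub>L\<^esub> f [x, y] = \<zero>\<^bsub>L\<^esub>"
  shows "f \<in> Z 2"
proof -
  interpret d: linear_map L "C 2" "C 3" "d 2"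
    using coboundary_linear[of 2] by (simp add: numeral_3_eq_3)
  have "d 2 f = \<zero>\<^bsub>C 3\<^esub>"
  proof (rule cochain_eqI[of _ 3])
    show "d 2 f xs = \<zero>\<^bsub>C 3\<^esub> xs" if "xs \<in> tuples G 3" for xs
      using that assms(2) coboundary_2[OF f] by (auto simp: cochain_simps tuples_3)
  qed (use f in simp_all)
  then show ?thesis using f unfolding cocycles_def by (simp add: numeral_3_eq_3)
qed

lemma coboundary_2_iff:
  "f \<in> B 2 \<longleftrightarrow> f \<in> carrier (C 2) \<and> (\<exists>c\<in>carrier (C 1). \<forall>x\<in>carrier G. \<forall>y\<in>carrier G.
     f [x, y] = c [y] \<ominus>\<^bsub>L\<^esub> c [x \<otimes>\<^bsub>G\<^esub> y] \<oplus>\<^bsub>L\<^esub> c [x])"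
proof -
  interpret d: linear_map L "C 1" "C 2" "d 1"
    using coboundary_linear[of 1] by (simp add: numeral_2_eq_2 One_nat_def)
  have *: "f = d 1 c \<longleftrightarrow> (\<forall>x\<in>carrier G. \<forall>y\<in>carrier G.
     f [x, y] = c [y] \<ominus>\<^bsub>L\<^esub> c [x \<otimes>\<^bsub>G\<^esub> y] \<oplus>\<^bsub>L\<^esub> c [x])"
    if f: "f \<in> carrier (C 2)" and c: "c \<in> carrier (C 1)" for f c
  proof
    assume *: "\<forall>x\<in>carrier G. \<forall>y\<in>carrier G.
     f [x, y] = c [y] \<ominus>\<^bsub>L\<^esub> c [x \<otimes>\<^bsub>G\<^esub> y] \<oplus>\<^bsub>L\<^esub> c [x]"
    show "f = d 1 c"
    proof (rule cochain_eqI[OF f])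
      show "f xs = d 1 c xs" if "xs \<in> tuples G 2" for xs
        using that * coboundary_1[OF c] by (auto simp: tuples_2)
    qed (use c in simp)
  qed (use coboundary_1[OF c] in simp)
  have "f \<in> B 2 \<longleftrightarrow> (\<exists>c\<in>carrier (C 1). f = d 1 c)"
    unfolding coboundaries_def by (auto simp: One_nat_def)
  also have "\<dots> \<longleftrightarrow> f \<in> carrier (C 2) \<and> (\<exists>c\<in>carrier (C 1). f = d 1 c)" by auto
  finally show ?thesis using * by blast
qed

lemma coboundaries_subset: "B 1 \<subseteq> Z 1" "B 2 \<subseteq> Z 2"
proof -
  interpret Z: submodule L "Z 1" "C 1" using subspace_cocycles[of 1] by (simp add: VectorSpace.subspace_def)
  show "B 1 \<subseteq> Z 1" unfolding coboundaries_1 using Z.zero_closed by simp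
  show "B 2 \<subseteq> Z 2"
  proof
    fix f assume "f \<in> B 2"
    then obtain c where f: "f \<in> carrier (C 2)" and c: "c \<in> carrier (C 1)"
      and eq: "\<And>x y. \<lbrakk>x \<in> carrier G; y \<in> carrier G\<rbrakk> \<Longrightarrow>
        f [x, y] = c [y] \<ominus>\<^bsub>L\<^esub> c [x \<otimes>\<^bsub>G\<^esub> y] \<oplus>\<^bsub>L\<^esub> c [x]"
      unfolding coboundary_2_iff by blast
    show "f \<in> Z 2"
    proof (rule cocycle_2I[OF f])
      fix x y z assume xyz: "x \<in> carrier G" "y \<in> carrier G" "z \<in> carrier G"
      have cl: "c [x] \<in> carrier L" "c [y] \<in> carrier L" "c [z] \<in> carrier L"
        "c [x \<otimes>\<^bsub>G\<^esub> y] \<in> carrier L" "c [y \<otimes>\<^bsub>G\<^esub> z] \<in> carrier L" "c [x \<otimes>\<^bsub>G\<^esub> (y \<otimes>\<^bsub>G\<^esub> z)] \<in> carrier L"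
        using xyz c cochain_1_closed by auto
      show "f [y, z] \<ominus>\<^bsub>L\<^esub> f [x \<otimes>\<^bsub>G\<^esub> y, z] \<oplus>\<^bsub>L\<^esub> f [x, y \<otimes>\<^bsub>G\<^esub> z] \<ominus>\<^bsub>L\<^esub> f [x, y] = \<zero>\<^bsub>L\<^esub>"
        using cl xyz
        by (simp add: eq G.m_assoc L.minus_eq L.minus_add L.minus_minus L.a_ac L.r_neg L.r_neg1 L.r_neg2)
    qed
  qed
qed

lemma cohomology_simps:
  assumes n: "n = 1 \<or> n = 2"
  shows "vectorspace L (H n)"
    and "carrier (H n) = (\<lambda>f. B n +>\<^bsub>C n\<^esub> f) ` Z n"
    and "\<zero>\<^bsub>H n\<^esub> = B n +>\<^bsub>C n\<^esub> \<zero>\<^bsub>C n\<^esub>"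
    and "\<lbrakk>f \<in> Z n; g \<in> Z n\<rbrakk> \<Longrightarrow>
      (B n +>\<^bsub>C n\<^esub> f) \<oplus>\<^bsub>H n\<^esub> (B n +>\<^bsub>C n\<^esub> g) = B n +>\<^bsub>C n\<^esub> (f \<oplus>\<^bsub>C n\<^esub> g)"
    and "\<lbrakk>c \<in> carrier L; f \<in> Z n\<rbrakk> \<Longrightarrow>
      c \<odot>\<^bsub>H n\<^esub> (B n +>\<^bsub>C n\<^esub> f) = B n +>\<^bsub>C n\<^esub> (c \<odot>\<^bsub>C n\<^esub> f)"
proof -
  interpret V: vectorspace L "C n" by (rule vectorspace_cochains)
  let ?Z = "(C n)\<lparr>carrier := Z n\<rparr>"
  interpret Z: vectorspace L ?Z by (rule V.subspace_is_vs[OF subspace_cocycles])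
  have "submodule L (B n) (C n)"
    using n subspace_coboundaries[of 0] subspace_coboundaries[of 1]
    by (auto simp: VectorSpace.subspace_def numeral_2_eq_2 One_nat_def)
  then have sub: "VectorSpace.subspace L (B n) ?Z"
    using n coboundaries_subset Z.vectorspace_axioms Z.module_axioms
    unfolding VectorSpace.subspace_def submodule_def by auto
  have coset: "B n +>\<^bsub>?Z\<^esub> f = B n +>\<^bsub>C n\<^esub> f" for f by (simp add: a_r_coset_def')
  note q = Z.quot_simps[OF sub, folded cohomology_def, unfolded coset, simplified]
  show "vectorspace L (H n)"
    using Z.quot_module_vectorspace[OF sub] by (simp add: cohomology_def)
  show "carrier (H n) = (\<lambda>f. B n +>\<^bsub>C n\<^esub> f) ` Z n" "\<zero>\<^bsub>H n\<^esub> = B n +>\<^bsub>C n\<^esub> \<zero>\<^bsub>C n\<^esub>"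
    by (fact q)+
  show "\<lbrakk>f \<in> Z n; g \<in> Z n\<rbrakk> \<Longrightarrow>
      (B n +>\<^bsub>C n\<^esub> f) \<oplus>\<^bsub>H n\<^esub> (B n +>\<^bsub>C n\<^esub> g) = B n +>\<^bsub>C n\<^esub> (f \<oplus>\<^bsub>C n\<^esub> g)"
    by (rule q)
  show "\<lbrakk>c \<in> carrier L; f \<in> Z n\<rbrakk> \<Longrightarrow>
      c \<odot>\<^bsub>H n\<^esub> (B n +>\<^bsub>C n\<^esub> f) = B n +>\<^bsub>C n\<^esub> (c \<odot>\<^bsub>C n\<^esub> f)"
    by (rule q)
qed

text \<open>With trivial coefficients the two faces of a one-tuple cancel, so the coboundaries in degree one
  vanish and a cohomology class of degree one is a singleton.\<close>

lemma coset_1: "f \<in> carrier (C 1) \<Longrightarrow> B 1 +>\<^bsub>C 1\<^esub> f = {f}"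
proof -
  interpret V: vectorspace L "C 1" by (rule vectorspace_cochains)
  show "f \<in> carrier (C 1) \<Longrightarrow> B 1 +>\<^bsub>C 1\<^esub> f = {f}"
    unfolding coboundaries_1 by (simp add: a_r_coset_def')
qed

lemma cohomology_1_simps:
  shows "carrier (H 1) = (\<lambda>f. {f}) ` Z 1"
    and "\<zero>\<^bsub>H 1\<^esub> = {\<zero>\<^bsub>C 1\<^esub>}"
    and "\<lbrakk>f \<in> Z 1; g \<in> Z 1\<rbrakk> \<Longrightarrow> {f} \<oplus>\<^bsub>H 1\<^esub> {g} = {f \<oplus>\<^bsub>C 1\<^esub> g}"
    and "\<lbrakk>c \<in> carrier L; f \<in> Z 1\<rbrakk> \<Longrightarrow> c \<odot>\<^bsub>H 1\<^esub> {f} = {c \<odot>\<^bsub>C 1\<^esub> f}"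
proof -
  interpret V: vectorspace L "C 1" by (rule vectorspace_cochains)
  note q = cohomology_simps[of 1, simplified]
  show "carrier (H 1) = (\<lambda>f. {f}) ` Z 1"
    using q(2) coset_1 cocycle_1_closed by (simp cong: image_cong)
  show "\<zero>\<^bsub>H 1\<^esub> = {\<zero>\<^bsub>C 1\<^esub>}" using q(3) coset_1 by simp
  show "\<lbrakk>f \<in> Z 1; g \<in> Z 1\<rbrakk> \<Longrightarrow> {f} \<oplus>\<^bsub>H 1\<^esub> {g} = {f \<oplus>\<^bsub>C 1\<^esub> g}"
    using q(4)[of f g] cocycle_1_closed by (simp add: coset_1)
  show "\<lbrakk>c \<in> carrier L; f \<in> Z 1\<rbrakk> \<Longrightarrow> c \<odot>\<^bsub>H 1\<^esub> {f} = {c \<odot>\<^bsub>C 1\<^esub> f}"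
    using q(5)[of c f] cocycle_1_closed by (simp add: coset_1)
qed

section \<open>The cup product of two classes of degree one\<close>

abbreviation "cupc \<equiv> cup_cochain L G 1 1"

lemma cupc_apply:
  "\<lbrakk>x \<in> carrier G; y \<in> carrier G\<rbrakk> \<Longrightarrow> cupc f g [x, y] = f [x] \<otimes>\<^bsub>L\<^esub> g [y]"
  by (simp add: cup_cochain_def tuples_def take_Cons' drop_Cons')

lemma cupc_closed:
  assumes "f \<in> carrier (C 1)" "g \<in> carrier (C 1)"
  shows "cupc f g \<in> carrier (C 2)"
  using assms cochain_1_closed
  by (auto simp: cup_cochain_def cochain_simps(1)[of 2] tuples_2 take_Cons' drop_Cons')

lemma cupc_cocycle:
  assumes f: "f \<in> Z 1" and g: "g \<in> Z 1"
  shows "cupc f g \<in> Z 2"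
proof (rule cocycle_2I)
  have fC: "f \<in> carrier (C 1)" and gC: "g \<in> carrier (C 1)" using f g cocycle_1_closed by auto
  show "cupc f g \<in> carrier (C 2)" using fC gC by (rule cupc_closed)
  fix x y z assume xyz: "x \<in> carrier G" "y \<in> carrier G" "z \<in> carrier G"
  have "f [x] \<in> carrier L" "f [y] \<in> carrier L" "g [y] \<in> carrier L" "g [z] \<in> carrier L"
    using xyz fC gC cochain_1_closed by auto
  then show "cupc f g [y, z] \<ominus>\<^bsub>L\<^esub> cupc f g [x \<otimes>\<^bsub>G\<^esub> y, z] \<oplus>\<^bsub>L\<^esub> cupc f g [x, y \<otimes>\<^bsub>G\<^esub> z]
      \<ominus>\<^bsub>L\<^esub> cupc f g [x, y] = \<zero>\<^bsub>L\<^esub>"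
    using xyz f g cocycle_1_iff[OF fC] cocycle_1_iff[OF gC]
    by (simp add: cupc_apply L.l_distr L.r_distr L.minus_eq L.minus_add L.a_ac L.r_neg L.r_neg1 L.r_neg2)
qed

lemma cup_classes: "cup L G 1 1 {f} {g} = B 2 +>\<^bsub>C 2\<^esub> cupc f g"
  by (simp add: cup_def)

lemma cup_bilinear: "bilinear_pairing L (H 1) (H 2) (cup L G 1 1)"
proof -
  interpret V: vectorspace L "C 1" by (rule vectorspace_cochains)
  interpret V2: vectorspace L "C 2" by (rule vectorspace_cochains)
  interpret Z: submodule L "Z 1" "C 1" using subspace_cocycles[of 1] by (simp add: VectorSpace.subspace_def)
  note q = cohomology_simps[of 2, simplified] and q1 = cohomology_1_simps
  have cl: "cup L G 1 1 {f} {g} \<in> carrier (H 2)" if "f \<in> Z 1" "g \<in> Z 1" for f g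
    unfolding cup_classes q(2) using cupc_cocycle[OF that] by blast
  have eqI: "a = b" if "a \<in> carrier (C 2)" "b \<in> carrier (C 2)"
    "\<And>x y. \<lbrakk>x \<in> carrier G; y \<in> carrier G\<rbrakk> \<Longrightarrow> a [x, y] = b [x, y]" for a b
    using cochain_eqI[OF that(1,2)] that(3) by (auto simp: tuples_2)
  note val = cochain_1_closed[OF cocycle_1_closed]
  have C1: "(f \<oplus>\<^bsub>C 1\<^esub> g) [x] = f [x] \<oplus>\<^bsub>L\<^esub> g [x]" "(c \<odot>\<^bsub>C 1\<^esub> f) [x] = c \<otimes>\<^bsub>L\<^esub> f [x]"
    if "x \<in> carrier G" for f g c x
    using that by (simp_all add: cochain_simps tuples_def)
  have C2: "(f \<oplus>\<^bsub>C 2\<^esub> g) [x, y] = f [x, y] \<oplus>\<^bsub>L\<^esub> g [x, y]" "(c \<odot>\<^bsub>C 2\<^esub> f) [x, y] = c \<otimes>\<^bsub>L\<^esub> f [x, y]"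
    if "x \<in> carrier G" "y \<in> carrier G" for f g c x y
    using that by (simp_all add: cochain_simps tuples_def)
  note cupcl = cupc_closed[OF cocycle_1_closed cocycle_1_closed]
  have add_l: "cupc (f \<oplus>\<^bsub>C 1\<^esub> f') g = cupc f g \<oplus>\<^bsub>C 2\<^esub> cupc f' g"
    and add_r: "cupc g (f \<oplus>\<^bsub>C 1\<^esub> f') = cupc g f \<oplus>\<^bsub>C 2\<^esub> cupc g f'"
    if "f \<in> Z 1" "f' \<in> Z 1" "g \<in> Z 1" for f f' g
    using that by (intro eqI cupcl V2.M.a_closed Z.m_closed;
        simp add: cupc_apply C1 C2 val L.l_distr L.r_distr)+
  have sm_l: "cupc (c \<odot>\<^bsub>C 1\<^esub> f) g = c \<odot>\<^bsub>C 2\<^esub> cupc f g"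
    and sm_r: "cupc g (c \<odot>\<^bsub>C 1\<^esub> f) = c \<odot>\<^bsub>C 2\<^esub> cupc g f"
    if "c \<in> carrier L" "f \<in> Z 1" "g \<in> Z 1" for c f g
    using that by (intro eqI cupcl V2.module.smult_closed Z.smult_closed;
        simp add: cupc_apply C1 C2 val L.m_assoc L.m_lcomm)+
  let ?cup = "cup L G 1 1"
  have bil: "?cup ({f} \<oplus>\<^bsub>H 1\<^esub> {f'}) {g} = ?cup {f} {g} \<oplus>\<^bsub>H 2\<^esub> ?cup {f'} {g}"
    "?cup {g} ({f} \<oplus>\<^bsub>H 1\<^esub> {f'}) = ?cup {g} {f} \<oplus>\<^bsub>H 2\<^esub> ?cup {g} {f'}"
    if "f \<in> Z 1" "f' \<in> Z 1" "g \<in> Z 1" for f f' g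
    unfolding q1(3)[OF that(1,2)] cup_classes add_l[OF that] add_r[OF that]
    using that by (simp_all add: q(4) cupc_cocycle)
  have sm: "?cup (c \<odot>\<^bsub>H 1\<^esub> {f}) {g} = c \<odot>\<^bsub>H 2\<^esub> ?cup {f} {g}"
    "?cup {g} (c \<odot>\<^bsub>H 1\<^esub> {f}) = c \<odot>\<^bsub>H 2\<^esub> ?cup {g} {f}"
    if "c \<in> carrier L" "f \<in> Z 1" "g \<in> Z 1" for c f g
    unfolding q1(4)[OF that(1,2)] cup_classes sm_l[OF that] sm_r[OF that]
    using that by (simp_all add: q(5) cupc_cocycle)
  show ?thesis
    unfolding bilinear_pairing_def LinearCombinations.module_hom_def
  proof (intro ballI conjI CollectI allI impI funcsetI)
    fix X assume "X \<in> carrier (H 1)"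
    then obtain g where g: "g \<in> Z 1" "X = {g}" unfolding q1(1) by blast
    fix Y assume "Y \<in> carrier (H 1)"
    then obtain f where f: "f \<in> Z 1" "Y = {f}" unfolding q1(1) by blast
    show "?cup X Y \<in> carrier (H 2)" "?cup Y X \<in> carrier (H 2)" using f g cl by simp_all
  next
    fix X Y Y' assume "X \<in> carrier (H 1)" "Y \<in> carrier (H 1) \<and> Y' \<in> carrier (H 1)"
    then obtain g f f' where "g \<in> Z 1" "X = {g}" "f \<in> Z 1" "Y = {f}" "f' \<in> Z 1" "Y' = {f'}"
      unfolding q1(1) by blast
    then show "?cup X (Y \<oplus>\<^bsub>H 1\<^esub> Y') = ?cup X Y \<oplus>\<^bsub>H 2\<^esub> ?cup X Y'"
      "?cup (Y \<oplus>\<^bsub>H 1\<^esub> Y') X = ?cup Y X \<oplus>\<^bsub>H 2\<^esub> ?cup Y' X"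
      by (simp_all only: bil)
  next
    fix X c Y assume "X \<in> carrier (H 1)" "c \<in> carrier L \<and> Y \<in> carrier (H 1)"
    then obtain g f where "g \<in> Z 1" "X = {g}" "c \<in> carrier L" "f \<in> Z 1" "Y = {f}"
      unfolding q1(1) by blast
    then show "?cup X (c \<odot>\<^bsub>H 1\<^esub> Y) = c \<odot>\<^bsub>H 2\<^esub> ?cup X Y"
      "?cup (c \<odot>\<^bsub>H 1\<^esub> Y) X = c \<odot>\<^bsub>H 2\<^esub> ?cup Y X"
      by (simp_all only: sm)
  qed
qed

lemma cup_eq_zero_iff:
  assumes f: "f \<in> Z 1" and g: "g \<in> Z 1"
  shows "cup L G 1 1 {f} {g} = \<zero>\<^bsub>H 2\<^esub> \<longleftrightarrow>
    (\<exists>c\<in>carrier (C 1). \<forall>x\<in>carrier G. \<forall>y\<in>carrier G.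
       f [x] \<otimes>\<^bsub>L\<^esub> g [y] = c [y] \<ominus>\<^bsub>L\<^esub> c [x \<otimes>\<^bsub>G\<^esub> y] \<oplus>\<^bsub>L\<^esub> c [x])"
proof -
  interpret V: vectorspace L "C 2" by (rule vectorspace_cochains)
  have cl: "cupc f g \<in> carrier (C 2)" using f g by (simp add: cupc_closed cocycle_1_closed)
  have sub: "VectorSpace.subspace L (B 2) (C 2)"
    using subspace_coboundaries[of 1] by (simp add: Suc_1)
  have minus_0: "\<ominus>\<^bsub>C 2\<^esub> \<zero>\<^bsub>C 2\<^esub> = \<zero>\<^bsub>C 2\<^esub>" by (rule V.M.minus_equality) simp_all
  have "cup L G 1 1 {f} {g} = \<zero>\<^bsub>H 2\<^esub> \<longleftrightarrow> cupc f g \<ominus>\<^bsub>C 2\<^esub> \<zero>\<^bsub>C 2\<^esub> \<in> B 2"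
    unfolding cup_classes using cohomology_simps(3)[of 2] V.quot_coset_eq_iff[OF sub cl] by simp
  also have "\<dots> \<longleftrightarrow> cupc f g \<in> B 2" using cl unfolding a_minus_def minus_0 by simp
  finally show ?thesis unfolding coboundary_2_iff using cl by (simp add: cupc_apply)
qed

end

section \<open>First cohomology of a right-angled Artin group and its cup product\<close>

locale raag_cohomology = L: field L
  for L :: "('l, 'm) ring_scheme" and \<Gamma> :: "'v sgraph" +
  assumes simplicial: "fin_simplicial \<Gamma>"
begin

lemma edge_verts: "{v, w} \<in> edges \<Gamma> \<Longrightarrow> v \<in> verts \<Gamma> \<and> w \<in> verts \<Gamma>"
  using simplicial unfolding fin_simplicial_def by (auto simp: doubleton_eq_iff)

end

sublocale raag_cohomology \<subseteq> P: group_presentation "verts \<Gamma>" "raag_relators \<Gamma>"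
  using edge_verts by unfold_locales (auto simp: raag_relators_def)

sublocale raag_cohomology \<subseteq> monoid_cohomology L "raag \<Gamma>"
proof -
  interpret G: monoid "raag \<Gamma>" unfolding raag_def by (rule P.monoid_pres_group)
  show "monoid_cohomology L (raag \<Gamma>)" by unfold_locales
qed

context raag_cohomology
begin

abbreviation "gen \<equiv> raag_gen \<Gamma>"

lemma gen_closed: "v \<in> verts \<Gamma> \<Longrightarrow> gen v \<in> carrier (raag \<Gamma>)"
  using P.cls_in_carrier by (simp add: raag_gen_def raag_def)

text \<open>Both \<open>v w\<close> and \<open>w v\<close> are equal to \<open>(v w v\<inverse> w\<inverse>) w v\<close>: the first by free cancellation, the
  second by the relator.\<close>

lemma gens_commute:
  assumes e: "{v, w} \<in> edges \<Gamma>"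
  shows "gen v \<otimes>\<^bsub>raag \<Gamma>\<^esub> gen w = gen w \<otimes>\<^bsub>raag \<Gamma>\<^esub> gen v"
proof -
  have v: "v \<in> verts \<Gamma>" "w \<in> verts \<Gamma>" using edge_verts[OF e] by auto
  let ?eq = "pres_eq (verts \<Gamma>) (raag_relators \<Gamma>)"
  let ?r = "[(v, True), (w, True), (v, False), (w, False)]"
  have r: "?r \<in> raag_relators \<Gamma>" using e unfolding raag_relators_def by blast
  have "?eq (?r @ [(w, True), (v, True)]) [(w, True), (v, True)]"
    using pres_eq.relator[of "[]" "verts \<Gamma>" "[(w, True), (v, True)]" ?r] r v by simp
  moreover have "?eq (?r @ [(w, True), (v, True)]) [(v, True), (w, True), (v, False), (v, True)]"
    using pres_eq.cancel[of "[(v, True), (w, True), (v, False)]" "verts \<Gamma>" "[(v, True)]" w _ False] v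
    by simp
  moreover have "?eq [(v, True), (w, True), (v, False), (v, True)] [(v, True), (w, True)]"
    using pres_eq.cancel[of "[(v, True), (w, True)]" "verts \<Gamma>" "[]" v _ False] v by simp
  ultimately have "?eq [(v, True), (w, True)] [(w, True), (v, True)]"
    by (meson pres_eq.sym pres_eq.trans)
  then show ?thesis
    using v P.cls_eq_iff[of "[(v, True), (w, True)]"] by (simp add: raag_gen_def raag_def P.mult_cls)
qed

lemma hom_eqI:
  assumes K: "group K" and g: "g \<in> hom (raag \<Gamma>) K" and h: "h \<in> hom (raag \<Gamma>) K"
    and eq: "\<And>v. v \<in> verts \<Gamma> \<Longrightarrow> g (gen v) = h (gen v)" and x: "x \<in> carrier (raag \<Gamma>)"
  shows "g x = h x"
proof -
  obtain w where w: "w \<in> words (verts \<Gamma>)" "x = P.cls w"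
    using x unfolding raag_def by (rule P.carrierE)
  have "word_eval K (\<lambda>s. g (P.cls [(s, True)])) w = word_eval K (\<lambda>s. h (P.cls [(s, True)])) w"
    using w(1)
  proof (induction w)
    case (Cons a w)
    moreover obtain s b where "a = (s, b)" by (cases a)
    ultimately show ?case using eq[of s] by (simp add: raag_gen_def)
  qed simp
  then show ?thesis
    using P.hom_cls[OF K g[unfolded raag_def] w(1)] P.hom_cls[OF K h[unfolded raag_def] w(1)] w(2)
    by simp
qed

lemma hom_exists:
  assumes K: "group K" and \<phi>: "\<And>v. v \<in> verts \<Gamma> \<Longrightarrow> \<phi> v \<in> carrier K"
    and comm: "\<And>v w. {v, w} \<in> edges \<Gamma> \<Longrightarrow> \<phi> v \<otimes>\<^bsub>K\<^esub> \<phi> w = \<phi> w \<otimes>\<^bsub>K\<^esub> \<phi> v"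
  obtains h where "h \<in> hom (raag \<Gamma>) K" "\<And>v. v \<in> verts \<Gamma> \<Longrightarrow> h (gen v) = \<phi> v"
proof -
  interpret K: group K by fact
  have Pi: "\<phi> \<in> verts \<Gamma> \<rightarrow> carrier K" using \<phi> by auto
  have "word_eval K \<phi> r = \<one>\<^bsub>K\<^esub>" if r: "r \<in> raag_relators \<Gamma>" for r
  proof -
    obtain v w where e: "{v, w} \<in> edges \<Gamma>"
      and r: "r = [(v, True), (w, True), (v, False), (w, False)]"
      using r unfolding raag_relators_def by blast
    have cl: "\<phi> v \<in> carrier K" "\<phi> w \<in> carrier K" using edge_verts[OF e] \<phi> by auto
    then have "word_eval K \<phi> r = (\<phi> v \<otimes>\<^bsub>K\<^esub> \<phi> w) \<otimes>\<^bsub>K\<^esub> inv\<^bsub>K\<^esub> (\<phi> w \<otimes>\<^bsub>K\<^esub> \<phi> v)"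
      by (simp add: r K.inv_mult_group K.m_assoc)
    then show ?thesis using comm[OF e] cl by simp
  qed
  then obtain h where h: "h \<in> hom P.G K"
    "\<And>w. w \<in> words (verts \<Gamma>) \<Longrightarrow> h (P.cls w) = word_eval K \<phi> w"
    using P.universal_property[OF K Pi] by blast
  have "h (gen v) = \<phi> v" if "v \<in> verts \<Gamma>" for v
    using h(2)[of "[(v, True)]"] that \<phi> by (simp add: raag_gen_def)
  with h(1) that show ?thesis unfolding raag_def by blast
qed

lemma add_group: "group (add_monoid L)"
  by (rule L.a_group)

lemma cocycle_hom:
  assumes "f \<in> carrier (C 1)"
  shows "f \<in> Z 1 \<longleftrightarrow> (\<lambda>x. f [x]) \<in> hom (raag \<Gamma>) (add_monoid L)"
  using cocycle_1_iff[OF assms] cochain_1_closed[OF assms] by (auto simp: hom_def)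

lemma cocycle_of_hom:
  assumes h: "h \<in> hom (raag \<Gamma>) (add_monoid L)"
  obtains f where "f \<in> Z 1" "\<And>x. x \<in> carrier (raag \<Gamma>) \<Longrightarrow> f [x] = h x"
proof -
  define f where "f = (\<lambda>xs\<in>tuples (raag \<Gamma>) 1. h (hd xs))"
  have f: "f [x] = h x" if "x \<in> carrier (raag \<Gamma>)" for x
    using that by (simp add: f_def tuples_def)
  have "f \<in> carrier (C 1)"
    using h by (auto simp: f_def cochain_simps tuples_1 hom_def)
  moreover have "f [x \<otimes>\<^bsub>raag \<Gamma>\<^esub> y] = f [x] \<oplus>\<^bsub>L\<^esub> f [y]"
    if "x \<in> carrier (raag \<Gamma>)" "y \<in> carrier (raag \<Gamma>)" for x y
    using that h by (simp add: f hom_def)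
  ultimately have "f \<in> Z 1" by (simp add: cocycle_1_iff)
  with f that show ?thesis by blast
qed

lemma cocycle_exists:
  assumes "\<And>v. v \<in> verts \<Gamma> \<Longrightarrow> a v \<in> carrier L"
  obtains f where "f \<in> Z 1" "\<And>v. v \<in> verts \<Gamma> \<Longrightarrow> f [gen v] = a v"
proof -
  obtain h where h: "h \<in> hom (raag \<Gamma>) (add_monoid L)" "\<And>v. v \<in> verts \<Gamma> \<Longrightarrow> h (gen v) = a v"
    using hom_exists[OF add_group, of a] assms edge_verts by (auto simp: L.a_comm)
  obtain f where "f \<in> Z 1" "\<And>x. x \<in> carrier (raag \<Gamma>) \<Longrightarrow> f [x] = h x"
    using cocycle_of_hom[OF h(1)] by blast
  with h(2) gen_closed that show ?thesis by simp
qed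

lemma cocycle_eqI:
  assumes f: "f \<in> Z 1" and g: "g \<in> Z 1" and eq: "\<And>v. v \<in> verts \<Gamma> \<Longrightarrow> f [gen v] = g [gen v]"
  shows "f = g"
proof (rule cochain_eqI)
  show fC: "f \<in> carrier (C 1)" and gC: "g \<in> carrier (C 1)" using f g by (auto simp: cocycle_1_closed)
  fix xs assume "xs \<in> tuples (raag \<Gamma>) 1"
  then obtain x where "xs = [x]" "x \<in> carrier (raag \<Gamma>)" unfolding tuples_1 by blast
  then show "f xs = g xs"
    using hom_eqI[OF add_group, of "\<lambda>x. f [x]" "\<lambda>x. g [x]" x] f g fC gC eq cocycle_hom by simp
qed

text \<open>The value at a generator of the homomorphism that is the only element of the class.\<close>

definition coord :: "'v \<Rightarrow> ('v word set list \<Rightarrow> 'l) set \<Rightarrow> 'l" where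
  "coord v c = the_elem c [gen v]"

lemma coord_simp [simp]: "coord v {f} = f [gen v]"
  by (simp add: coord_def)

text \<open>The description that defines the dual class is proper, since a homomorphism to \<open>L\<close> can be
  prescribed arbitrarily on the generators and is determined by its values there.\<close>

lemma dual_class:
  assumes v: "v \<in> verts \<Gamma>"
  shows "dual_class L \<Gamma> v \<in> carrier (H 1)"
    and "w \<in> verts \<Gamma> \<Longrightarrow> coord w (dual_class L \<Gamma> v) = (if w = v then \<one>\<^bsub>L\<^esub> else \<zero>\<^bsub>L\<^esub>)"
proof -
  obtain f where f: "f \<in> Z 1"
    "\<And>u. u \<in> verts \<Gamma> \<Longrightarrow> f [gen u] = (if u = v then \<one>\<^bsub>L\<^esub> else \<zero>\<^bsub>L\<^esub>)"
  proof -
    have "(if u = v then \<one>\<^bsub>L\<^esub> else \<zero>\<^bsub>L\<^esub>) \<in> carrier L" for u by simp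
    from cocycle_exists[of "\<lambda>u. if u = v then \<one>\<^bsub>L\<^esub> else \<zero>\<^bsub>L\<^esub>", OF this] that show ?thesis by blast
  qed
  have "dual_class L \<Gamma> v = {f}"
    unfolding dual_class_def
  proof (rule the_equality)
    show "{f} \<in> carrier (H 1) \<and>
      (\<forall>g\<in>{f}. \<forall>u\<in>verts \<Gamma>. g [gen u] = (if u = v then \<one>\<^bsub>L\<^esub> else \<zero>\<^bsub>L\<^esub>))"
      using f by (simp add: cohomology_1_simps(1))
    fix c assume c: "c \<in> carrier (H 1) \<and>
      (\<forall>g\<in>c. \<forall>u\<in>verts \<Gamma>. g [gen u] = (if u = v then \<one>\<^bsub>L\<^esub> else \<zero>\<^bsub>L\<^esub>))"
    then obtain g where g: "g \<in> Z 1" "c = {g}" unfolding cohomology_1_simps(1) by blast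
    then have "g = f" using c f by (intro cocycle_eqI) simp_all
    then show "c = {f}" using g by simp
  qed
  then show "dual_class L \<Gamma> v \<in> carrier (H 1)"
    "w \<in> verts \<Gamma> \<Longrightarrow> coord w (dual_class L \<Gamma> v) = (if w = v then \<one>\<^bsub>L\<^esub> else \<zero>\<^bsub>L\<^esub>)"
    using f by (simp_all add: cohomology_1_simps(1))
qed

lemma coordinates_H1: "coordinates L (H 1) (verts \<Gamma>) (dual_class L \<Gamma>) coord"
proof (intro coordinates.intro coordinates_axioms.intro)
  show "vectorspace L (H 1)" by (rule cohomology_simps) simp
  show "finite (verts \<Gamma>)" using simplicial unfolding fin_simplicial_def by blast
  fix v assume v: "v \<in> verts \<Gamma>"
  show "dual_class L \<Gamma> v \<in> carrier (H 1)" by (rule dual_class(1)[OF v])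
  show "w \<in> verts \<Gamma> \<Longrightarrow> coord v (dual_class L \<Gamma> w) = (if v = w then \<one>\<^bsub>L\<^esub> else \<zero>\<^bsub>L\<^esub>)" for w
    by (rule dual_class(2)[OF _ v])
  fix c assume "c \<in> carrier (H 1)"
  then obtain f where f: "f \<in> Z 1" "c = {f}" unfolding cohomology_1_simps(1) by blast
  then show "coord v c \<in> carrier L"
    using cochain_1_closed[OF cocycle_1_closed gen_closed] v by simp
  show "a \<in> carrier L \<Longrightarrow> coord v (a \<odot>\<^bsub>H 1\<^esub> c) = a \<otimes>\<^bsub>L\<^esub> coord v c" for a
    using f v gen_closed by (simp add: cohomology_1_simps(4) cochain_simps tuples_def)
  fix c' assume "c' \<in> carrier (H 1)"
  then obtain f' where f': "f' \<in> Z 1" "c' = {f'}" unfolding cohomology_1_simps(1) by blast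
  then show "coord v (c \<oplus>\<^bsub>H 1\<^esub> c') = coord v c \<oplus>\<^bsub>L\<^esub> coord v c'"
    using f v gen_closed by (simp add: cohomology_1_simps(3) cochain_simps tuples_def)
next
  fix c assume "c \<in> carrier (H 1)" and 0: "\<And>v. v \<in> verts \<Gamma> \<Longrightarrow> coord v c = \<zero>\<^bsub>L\<^esub>"
  then obtain f where f: "f \<in> Z 1" "c = {f}" unfolding cohomology_1_simps(1) by blast
  interpret Z: submodule L "Z 1" "C 1"
    using subspace_cocycles[of 1] by (simp add: VectorSpace.subspace_def)
  have "\<zero>\<^bsub>C 1\<^esub> [gen v] = \<zero>\<^bsub>L\<^esub>" if "v \<in> verts \<Gamma>" for v
    using gen_closed[OF that] by (simp add: cochain_simps(2) tuples_def)
  then have "f = \<zero>\<^bsub>C 1\<^esub>"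
    using f 0 by (intro cocycle_eqI Z.zero_closed) simp_all
  then show "c = \<zero>\<^bsub>H 1\<^esub>" using f by (simp add: cohomology_1_simps(2))
qed

text \<open>Let the product of the homomorphisms \<open>f\<close> and \<open>g\<close> be the coboundary of \<open>c\<close>. Evaluated at a pair
  of generators, a coboundary depends only on the unordered pair if the generators commute, and this is
  the condition on the edges. Conversely, the condition on the edges says that the elements
  \<open>(f v, g v, 0)\<close> of the Heisenberg group commute for adjacent \<open>v\<close>. They thus define a
  homomorphism from the Artin group to the Heisenberg group that lifts \<open>(f, g)\<close>, and minus its
  corner entry has coboundary the product of \<open>f\<close> and \<open>g\<close>.\<close>

theorem cup_eq_zero_iff_edges:
  assumes a: "a \<in> carrier (H 1)" and b: "b \<in> carrier (H 1)"
  shows "raag_cup L \<Gamma> a b = \<zero>\<^bsub>H 2\<^esub> \<longleftrightarrow>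
    (\<forall>v w. {v, w} \<in> edges \<Gamma> \<longrightarrow> coord v a \<otimes>\<^bsub>L\<^esub> coord w b = coord w a \<otimes>\<^bsub>L\<^esub> coord v b)"
proof -
  obtain f where f: "f \<in> Z 1" "a = {f}" using a unfolding cohomology_1_simps(1) by blast
  obtain g where g: "g \<in> Z 1" "b = {g}" using b unfolding cohomology_1_simps(1) by blast
  note fC = cocycle_1_closed[OF f(1)] and gC = cocycle_1_closed[OF g(1)]
  note val = cochain_1_closed[OF fC] cochain_1_closed[OF gC]
  let ?G = "raag \<Gamma>"
  have "(\<exists>c\<in>carrier (C 1). \<forall>x\<in>carrier ?G. \<forall>y\<in>carrier ?G.
       f [x] \<otimes>\<^bsub>L\<^esub> g [y] = c [y] \<ominus>\<^bsub>L\<^esub> c [x \<otimes>\<^bsub>?G\<^esub> y] \<oplus>\<^bsub>L\<^esub> c [x]) \<longleftrightarrow>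
    (\<forall>v w. {v, w} \<in> edges \<Gamma> \<longrightarrow> f [gen v] \<otimes>\<^bsub>L\<^esub> g [gen w] = f [gen w] \<otimes>\<^bsub>L\<^esub> g [gen v])"
  proof
    assume "\<exists>c\<in>carrier (C 1). \<forall>x\<in>carrier ?G. \<forall>y\<in>carrier ?G.
       f [x] \<otimes>\<^bsub>L\<^esub> g [y] = c [y] \<ominus>\<^bsub>L\<^esub> c [x \<otimes>\<^bsub>?G\<^esub> y] \<oplus>\<^bsub>L\<^esub> c [x]"
    then obtain c where c: "c \<in> carrier (C 1)" and eq: "\<And>x y. \<lbrakk>x \<in> carrier ?G; y \<in> carrier ?G\<rbrakk> \<Longrightarrow>
       f [x] \<otimes>\<^bsub>L\<^esub> g [y] = c [y] \<ominus>\<^bsub>L\<^esub> c [x \<otimes>\<^bsub>?G\<^esub> y] \<oplus>\<^bsub>L\<^esub> c [x]"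
      by blast
    show "\<forall>v w. {v, w} \<in> edges \<Gamma> \<longrightarrow> f [gen v] \<otimes>\<^bsub>L\<^esub> g [gen w] = f [gen w] \<otimes>\<^bsub>L\<^esub> g [gen v]"
    proof (intro allI impI)
      fix v w assume e: "{v, w} \<in> edges \<Gamma>"
      then have cl: "gen v \<in> carrier ?G" "gen w \<in> carrier ?G" using edge_verts gen_closed by auto
      have "gen w \<otimes>\<^bsub>?G\<^esub> gen v \<in> carrier ?G" using cl by simp
      then have c': "c [gen v] \<in> carrier L" "c [gen w] \<in> carrier L" "c [gen w \<otimes>\<^bsub>?G\<^esub> gen v] \<in> carrier L"
        using cl cochain_1_closed[OF c] by auto
      have 1: "f [gen v] \<otimes>\<^bsub>L\<^esub> g [gen w] = c [gen w] \<ominus>\<^bsub>L\<^esub> c [gen w \<otimes>\<^bsub>?G\<^esub> gen v] \<oplus>\<^bsub>L\<^esub> c [gen v]"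
        using eq[OF cl] gens_commute[OF e] by simp
      have 2: "f [gen w] \<otimes>\<^bsub>L\<^esub> g [gen v] = c [gen v] \<ominus>\<^bsub>L\<^esub> c [gen w \<otimes>\<^bsub>?G\<^esub> gen v] \<oplus>\<^bsub>L\<^esub> c [gen w]"
        by (rule eq[OF cl(2,1)])
      show "f [gen v] \<otimes>\<^bsub>L\<^esub> g [gen w] = f [gen w] \<otimes>\<^bsub>L\<^esub> g [gen v]"
        unfolding 1 2 using c' by (simp add: L.minus_eq L.a_ac)
    qed
  next
    assume comm: "\<forall>v w. {v, w} \<in> edges \<Gamma> \<longrightarrow>
      f [gen v] \<otimes>\<^bsub>L\<^esub> g [gen w] = f [gen w] \<otimes>\<^bsub>L\<^esub> g [gen v]"
    define \<phi> where "\<phi> v = (f [gen v], g [gen v], \<zero>\<^bsub>L\<^esub>)" for v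
    have \<phi>_cl: "\<phi> v \<in> carrier (heisenberg L)" if "v \<in> verts \<Gamma>" for v
      using val gen_closed[OF that] by (simp add: \<phi>_def)
    have \<phi>_comm: "\<phi> v \<otimes>\<^bsub>heisenberg L\<^esub> \<phi> w = \<phi> w \<otimes>\<^bsub>heisenberg L\<^esub> \<phi> v"
      if "{v, w} \<in> edges \<Gamma>" for v w
    proof -
      have "f [gen v] \<otimes>\<^bsub>L\<^esub> g [gen w] = f [gen w] \<otimes>\<^bsub>L\<^esub> g [gen v]" using comm that by blast
      then show ?thesis using val gen_closed edge_verts[OF that] by (simp add: \<phi>_def L.a_comm)
    qed
    obtain h where h: "h \<in> hom ?G (heisenberg L)" and h\<phi>: "\<And>v. v \<in> verts \<Gamma> \<Longrightarrow> h (gen v) = \<phi> v"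
      using hom_exists[where \<phi> = \<phi>, OF L.heisenberg_group \<phi>_cl \<phi>_comm] by blast
    define p q r where "p = fst \<circ> h" and "q = fst \<circ> snd \<circ> h" and "r = snd \<circ> snd \<circ> h"
    have hx: "h x = (p x, q x, r x)" for x by (simp add: p_def q_def r_def)
    have hcl: "p x \<in> carrier L" "q x \<in> carrier L" "r x \<in> carrier L" if "x \<in> carrier ?G" for x
      using hom_carrier[OF h] that hx[of x] by (auto simp: image_subset_iff)
    have hmult: "p (x \<otimes>\<^bsub>?G\<^esub> y) = p x \<oplus>\<^bsub>L\<^esub> p y" "q (x \<otimes>\<^bsub>?G\<^esub> y) = q x \<oplus>\<^bsub>L\<^esub> q y"
      "r (x \<otimes>\<^bsub>?G\<^esub> y) = r x \<oplus>\<^bsub>L\<^esub> r y \<oplus>\<^bsub>L\<^esub> p x \<otimes>\<^bsub>L\<^esub> q y"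
      if "x \<in> carrier ?G" "y \<in> carrier ?G" for x y
      using hom_mult[OF h that] by (simp_all add: hx)
    have hom: "p \<in> hom ?G (add_monoid L)" "q \<in> hom ?G (add_monoid L)"
      using hcl hmult by (auto simp: hom_def)
    have pf: "p x = f [x]" if "x \<in> carrier ?G" for x
      using hom_eqI[OF add_group hom(1) _ _ that, of "\<lambda>x. f [x]"] f(1) fC cocycle_hom h\<phi>
      by (simp add: p_def \<phi>_def)
    have qg: "q x = g [x]" if "x \<in> carrier ?G" for x
      using hom_eqI[OF add_group hom(2) _ _ that, of "\<lambda>x. g [x]"] g(1) gC cocycle_hom h\<phi>
      by (simp add: q_def \<phi>_def)
    define c where "c = (\<lambda>xs\<in>tuples ?G 1. \<ominus>\<^bsub>L\<^esub> r (hd xs))"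
    have c: "c [x] = \<ominus>\<^bsub>L\<^esub> r x" if "x \<in> carrier ?G" for x
      using that by (simp add: c_def tuples_def)
    have "c \<in> carrier (C 1)" using hcl by (auto simp: c_def cochain_simps tuples_1)
    moreover have "f [x] \<otimes>\<^bsub>L\<^esub> g [y] = c [y] \<ominus>\<^bsub>L\<^esub> c [x \<otimes>\<^bsub>?G\<^esub> y] \<oplus>\<^bsub>L\<^esub> c [x]"
      if xy: "x \<in> carrier ?G" "y \<in> carrier ?G" for x y
    proof -
      have "f [x] \<otimes>\<^bsub>L\<^esub> g [y] = p x \<otimes>\<^bsub>L\<^esub> q y" using pf qg xy by simp
      moreover have "p x \<otimes>\<^bsub>L\<^esub> q y \<in> carrier L" using hcl xy by simp
      ultimately show ?thesis
        using xy hcl[OF xy(1)] hcl[OF xy(2)]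
        by (simp add: c hmult L.minus_eq L.minus_minus L.a_ac L.r_neg1 L.r_neg2)
    qed
    ultimately show "\<exists>c\<in>carrier (C 1). \<forall>x\<in>carrier ?G. \<forall>y\<in>carrier ?G.
       f [x] \<otimes>\<^bsub>L\<^esub> g [y] = c [y] \<ominus>\<^bsub>L\<^esub> c [x \<otimes>\<^bsub>?G\<^esub> y] \<oplus>\<^bsub>L\<^esub> c [x]"
      by blast
  qed
  then show ?thesis using cup_eq_zero_iff[OF f(1) g(1)] f(2) g(2) by simp
qed

corollary cup_alternating:
  assumes "a \<in> carrier (H 1)"
  shows "raag_cup L \<Gamma> a a = \<zero>\<^bsub>H 2\<^esub>"
  using cup_eq_zero_iff_edges[OF assms assms] edge_verts
    coordinates.x_closed[OF coordinates_H1 _ assms] by (auto simp: L.m_comm)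

end

section \<open>Bilinear pairings\<close>

lemma bilinear_pairingD:
  assumes "bilinear_pairing L V W q"
  shows "\<lbrakk>x \<in> carrier V; y \<in> carrier V\<rbrakk> \<Longrightarrow> q x y \<in> carrier W"
    and "\<lbrakk>x \<in> carrier V; y \<in> carrier V; z \<in> carrier V\<rbrakk> \<Longrightarrow> q x (y \<oplus>\<^bsub>V\<^esub> z) = q x y \<oplus>\<^bsub>W\<^esub> q x z"
    and "\<lbrakk>x \<in> carrier V; y \<in> carrier V; z \<in> carrier V\<rbrakk> \<Longrightarrow> q (y \<oplus>\<^bsub>V\<^esub> z) x = q y x \<oplus>\<^bsub>W\<^esub> q z x"
    and "\<lbrakk>x \<in> carrier V; c \<in> carrier L; y \<in> carrier V\<rbrakk> \<Longrightarrow> q x (c \<odot>\<^bsub>V\<^esub> y) = c \<odot>\<^bsub>W\<^esub> q x y"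
    and "\<lbrakk>x \<in> carrier V; c \<in> carrier L; y \<in> carrier V\<rbrakk> \<Longrightarrow> q (c \<odot>\<^bsub>V\<^esub> y) x = c \<odot>\<^bsub>W\<^esub> q y x"
  using assms unfolding bilinear_pairing_def LinearCombinations.module_hom_def by auto

lemma annihilator_subspace:
  assumes V: "vectorspace L V" and W: "vectorspace L W" and q: "bilinear_pairing L V W q"
    and F: "F \<subseteq> carrier V"
  shows "VectorSpace.subspace L (annihilator V W q F) V"
proof -
  interpret V: vectorspace L V by fact
  interpret W: vectorspace L W by fact
  note q = bilinear_pairingD[OF q]
  have zero: "q f \<zero>\<^bsub>V\<^esub> = \<zero>\<^bsub>W\<^esub>" if "f \<in> carrier V" for f
    using q(4)[OF that, of "\<zero>\<^bsub>L\<^esub>" "\<zero>\<^bsub>V\<^esub>"] q(1)[OF that, of "\<zero>\<^bsub>V\<^esub>"] by simp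
  have "submodule L (annihilator V W q F) V"
  proof
    show "annihilator V W q F \<subseteq> carrier V" by (auto simp: annihilator_def)
    show "\<zero>\<^bsub>V\<^esub> \<in> annihilator V W q F" using F zero by (auto simp: annihilator_def)
  next
    fix v w assume "v \<in> annihilator V W q F" "w \<in> annihilator V W q F"
    then show "v \<oplus>\<^bsub>V\<^esub> w \<in> annihilator V W q F"
      using F q(2) by (auto simp: annihilator_def subset_iff)
  next
    fix c v assume "c \<in> carrier L" "v \<in> annihilator V W q F"
    then show "c \<odot>\<^bsub>V\<^esub> v \<in> annihilator V W q F"
      using F q(4) by (auto simp: annihilator_def subset_iff)
  qed
  then show ?thesis using V by (simp add: VectorSpace.subspace_def)
qed

lemma alternating_antisymmetric:
  assumes V: "vectorspace L V" and W: "vectorspace L W" and q: "bilinear_pairing L V W q"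
    and alt: "\<And>x. x \<in> carrier V \<Longrightarrow> q x x = \<zero>\<^bsub>W\<^esub>"
    and x: "x \<in> carrier V" and y: "y \<in> carrier V"
  shows "q y x = \<ominus>\<^bsub>W\<^esub> q x y"
proof -
  interpret V: vectorspace L V by fact
  interpret W: vectorspace L W by fact
  note q = bilinear_pairingD[OF q]
  have cl: "q x y \<in> carrier W" "q y x \<in> carrier W" using q(1) x y by auto
  have "\<zero>\<^bsub>W\<^esub> = q (x \<oplus>\<^bsub>V\<^esub> y) (x \<oplus>\<^bsub>V\<^esub> y)" using alt x y by simp
  also have "\<dots> = (q x x \<oplus>\<^bsub>W\<^esub> q y x) \<oplus>\<^bsub>W\<^esub> (q x y \<oplus>\<^bsub>W\<^esub> q y y)"
    using x y q(2)[of "x \<oplus>\<^bsub>V\<^esub> y" x y] q(3)[of x x y] q(3)[of y x y] by simp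
  also have "\<dots> = q x y \<oplus>\<^bsub>W\<^esub> q y x"
    using x y cl by (simp add: alt W.M.a_comm)
  finally have "q y x \<oplus>\<^bsub>W\<^esub> q x y = \<zero>\<^bsub>W\<^esub>" using cl by (simp add: W.M.a_comm)
  then show ?thesis using W.M.minus_equality cl by simp
qed

lemma line_vectorspace:
  assumes "field L"
  shows "vectorspace L (line L)"
proof -
  interpret L: field L by fact
  show ?thesis
    by (rule vs_criteria)
      (auto simp: line_def L.field_axioms L.a_ac L.m_assoc L.l_distr L.r_distr
        intro!: bexI[of _ "\<ominus>\<^bsub>L\<^esub> _"] L.r_neg)
qed

lemma direct_sum_simps:
  "carrier (direct_sum V W) = carrier V \<times> carrier W"
  "\<zero>\<^bsub>direct_sum V W\<^esub> = (\<zero>\<^bsub>V\<^esub>, \<zero>\<^bsub>W\<^esub>)"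
  "(v, w) \<oplus>\<^bsub>direct_sum V W\<^esub> (v', w') = (v \<oplus>\<^bsub>V\<^esub> v', w \<oplus>\<^bsub>W\<^esub> w')"
  "c \<odot>\<^bsub>direct_sum V W\<^esub> (v, w) = (c \<odot>\<^bsub>V\<^esub> v, c \<odot>\<^bsub>W\<^esub> w)"
  by (simp_all add: direct_sum_def)

section \<open>Adding the square of one vertex to the cup product\<close>

locale perturbed_cup = raag_cohomology L \<Gamma>
  for L :: "('l, 'm) ring_scheme" and \<Gamma> :: "'v sgraph" +
  fixes v0 :: 'v and q0 :: "('v word set list \<Rightarrow> 'l) set \<Rightarrow> ('v word set list \<Rightarrow> 'l) set \<Rightarrow> 'l"
  assumes v0: "v0 \<in> verts \<Gamma>"
    and q0_bilinear: "bilinear_pairing L (raag_H L \<Gamma> 1) (line L) q0"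
    and q0_dual: "\<lbrakk>v \<in> verts \<Gamma>; w \<in> verts \<Gamma>\<rbrakk> \<Longrightarrow>
      q0 (dual_class L \<Gamma> v) (dual_class L \<Gamma> w) = (if v = v0 \<and> w = v0 then \<one>\<^bsub>L\<^esub> else \<zero>\<^bsub>L\<^esub>)"
begin

sublocale coordinates L "H 1" "verts \<Gamma>" "dual_class L \<Gamma>" coord
  by (rule coordinates_H1)

definition W' where "W' = direct_sum (H 2) (line L)"
definition q' where "q' x y = (raag_cup L \<Gamma> x y, q0 x y)"

lemma vs_H1: "vectorspace L (H 1)" and vs_H2: "vectorspace L (H 2)"
  using cohomology_simps(1) by auto

lemma vs_line: "vectorspace L (line L)"
  by (rule line_vectorspace[OF L.field_axioms])

lemma vs_W': "vectorspace L W'"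
  unfolding W'_def by (rule direct_sum_is_vs[OF vs_H2 vs_line])

lemma zero_line: "\<zero>\<^bsub>line L\<^esub> = \<zero>\<^bsub>L\<^esub>"
  by (simp add: line_def)

lemma q'_eq_zero_iff: "q' x y = \<zero>\<^bsub>W'\<^esub> \<longleftrightarrow> raag_cup L \<Gamma> x y = \<zero>\<^bsub>H 2\<^esub> \<and> q0 x y = \<zero>\<^bsub>L\<^esub>"
  by (simp add: q'_def W'_def direct_sum_simps zero_line)

lemma q'_bilinear: "bilinear_pairing L (H 1) W' q'"
  using bilinear_pairingD[OF cup_bilinear] bilinear_pairingD[OF q0_bilinear]
  unfolding bilinear_pairing_def LinearCombinations.module_hom_def
  by (simp add: q'_def W'_def direct_sum_simps Pi_iff)

text \<open>The two orders agree on the dual basis; linearity extends this to one argument at a time.\<close>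

lemma q0_symmetric:
  assumes x: "x \<in> carrier (H 1)" and y: "y \<in> carrier (H 1)"
  shows "q0 x y = q0 y x"
proof -
  have hom: "(\<lambda>y. q0 x y) \<in> LinearCombinations.module_hom L (H 1) (line L)"
    "(\<lambda>y. q0 y x) \<in> LinearCombinations.module_hom L (H 1) (line L)" if "x \<in> carrier (H 1)" for x
    using q0_bilinear that unfolding bilinear_pairing_def by auto
  have "q0 x (dual_class L \<Gamma> w) = q0 (dual_class L \<Gamma> w) x" if w: "w \<in> verts \<Gamma>" for w
    by (rule coordinates.hom_eqI[OF coordinates_H1 vs_line hom(2,1)[OF dual_class(1)[OF w]] _ x])
      (auto simp: q0_dual w)
  then show ?thesis
    by (intro coordinates.hom_eqI[OF coordinates_H1 vs_line hom(1,2)[OF x] _ y])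
qed

lemma cup_antisymmetric:
  assumes "x \<in> carrier (H 1)" "y \<in> carrier (H 1)"
  shows "raag_cup L \<Gamma> y x = \<ominus>\<^bsub>H 2\<^esub> raag_cup L \<Gamma> x y"
  by (rule alternating_antisymmetric[OF vs_H1 vs_H2 cup_bilinear cup_alternating assms])

text \<open>The symmetric summand of the target is the added line, and the anti-symmetric one is the second
  cohomology.\<close>

lemma q'_sym_antisym: "sym_antisym_pairing L (H 1) W' q'"
proof -
  interpret H2: vectorspace L "H 2" by (rule vs_H2)
  interpret line: vectorspace L "line L" by (rule vs_line)
  interpret W: vectorspace L W' by (rule vs_W')
  note W_simps = direct_sum_simps[of "H 2" "line L", folded W'_def]
  let ?P = "{\<zero>\<^bsub>H 2\<^esub>} \<times> carrier (line L)" and ?M = "carrier (H 2) \<times> {\<zero>\<^bsub>line L\<^esub>}"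
  have P: "VectorSpace.subspace L ?P W'"
    unfolding VectorSpace.subspace_def submodule_def
    using vs_W' W.module_axioms by (auto simp: W_simps)
  have M: "VectorSpace.subspace L ?M W'"
    unfolding VectorSpace.subspace_def submodule_def
    using vs_W' W.module_axioms by (auto simp: W_simps)
  have "\<exists>s\<in>?P. \<exists>a\<in>?M. q' x y = s \<oplus>\<^bsub>W'\<^esub> a \<and> q' y x = s \<ominus>\<^bsub>W'\<^esub> a"
    if x: "x \<in> carrier (H 1)" and y: "y \<in> carrier (H 1)" for x y
  proof (intro bexI conjI)
    let ?c = "raag_cup L \<Gamma> x y" and ?l = "q0 x y"
    have c: "?c \<in> carrier (H 2)" and l: "?l \<in> carrier (line L)"
      using bilinear_pairingD(1)[OF cup_bilinear x y] bilinear_pairingD(1)[OF q0_bilinear x y] by auto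
    show "(\<zero>\<^bsub>H 2\<^esub>, ?l) \<in> ?P" "(?c, \<zero>\<^bsub>line L\<^esub>) \<in> ?M" using c l by auto
    show "q' x y = (\<zero>\<^bsub>H 2\<^esub>, ?l) \<oplus>\<^bsub>W'\<^esub> (?c, \<zero>\<^bsub>line L\<^esub>)"
      using c l by (simp add: q'_def W_simps)
    have "\<ominus>\<^bsub>W'\<^esub> (?c, \<zero>\<^bsub>line L\<^esub>) = (\<ominus>\<^bsub>H 2\<^esub> ?c, \<zero>\<^bsub>line L\<^esub>)"
      using c by (intro W.M.minus_equality) (auto simp: W_simps H2.M.l_neg)
    then show "q' y x = (\<zero>\<^bsub>H 2\<^esub>, ?l) \<ominus>\<^bsub>W'\<^esub> (?c, \<zero>\<^bsub>line L\<^esub>)"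
      using c l cup_antisymmetric[OF x y] q0_symmetric[OF x y]
      by (simp add: a_minus_def q'_def W_simps)
  qed
  moreover have "?P \<inter> ?M = {\<zero>\<^bsub>W'\<^esub>}" by (auto simp: W_simps)
  ultimately show ?thesis unfolding sym_antisym_pairing_def using P M by blast
qed

lemma triple: "is_triple L (H 1) W' q'"
  unfolding is_triple_def using vs_H1 vs_W' q'_bilinear q'_sym_antisym fin_dim by blast

text \<open>Every vector that annihilates \<open>F\<close> under \<open>q'\<close> does so under the cup product. The
  determinant conditions on the edges therefore hold between \<open>F\<close> and its annihilator under \<open>q'\<close>, and
  the lower bound on the codimension of their sum follows from these.\<close>

lemma cheeger_ge:
  fixes \<epsilon> :: real
  assumes \<epsilon>: "0 < \<epsilon>" "\<epsilon> \<le> graph_cheeger \<Gamma>"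
  shows "ereal (\<epsilon>\<^sup>2 / (1 + \<epsilon>)) \<le> triple_cheeger L (H 1) W' q'"
  unfolding triple_cheeger_def
proof (rule INF_greatest)
  fix F assume "F \<in> {F. VectorSpace.subspace L F (H 1) \<and> 0 < subdim L (H 1) F \<and>
    2 * subdim L (H 1) F \<le> dim}"
  then have F: "VectorSpace.subspace L F (H 1)" and pos: "0 < subdim L (H 1) F"
    and half: "2 * subdim L (H 1) F \<le> dim" by auto
  have FV: "F \<subseteq> carrier (H 1)" using subspace_closed(1)[OF F] by blast
  let ?C = "annihilator (H 1) W' q' F"
  have expand: "\<epsilon> * card A \<le> card (vertex_boundary \<Gamma> A)"
    if A: "A \<subseteq> verts \<Gamma>" "A \<noteq> {}" "2 * card A \<le> card (verts \<Gamma>)" for A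
  proof -
    have "graph_cheeger \<Gamma> \<le> ereal (real (card (vertex_boundary \<Gamma> A)) / real (card A))"
      unfolding graph_cheeger_def using A by (intro INF_lower) simp
    then have "\<epsilon> \<le> real (card (vertex_boundary \<Gamma> A)) / real (card A)"
      using \<epsilon>(2) order_trans by fastforce
    moreover have "0 < card A" using A finite_index finite_subset card_gt_0_iff by blast
    ultimately show ?thesis by (simp add: field_simps)
  qed
  have comm: "coord v f \<otimes>\<^bsub>L\<^esub> coord w y = coord w f \<otimes>\<^bsub>L\<^esub> coord v y"
    if "f \<in> F" "y \<in> ?C" "{v, w} \<in> edges \<Gamma>" for f y v w
  proof -
    have y: "y \<in> carrier (H 1)" "q' f y = \<zero>\<^bsub>W'\<^esub>" using that by (auto simp: annihilator_def)
    have f: "f \<in> carrier (H 1)" using that FV by blast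
    show ?thesis
      using y(2) that(3) cup_eq_zero_iff_edges[OF f y(1)] unfolding q'_eq_zero_iff by blast
  qed
  have "\<epsilon>\<^sup>2 / (1 + \<epsilon>) * subdim L (H 1) F
      \<le> real dim - subdim L (H 1) F - subdim L (H 1) ?C + subdim L (H 1) (?C \<inter> F)"
    by (rule expansion_of_pairing[OF simplicial HOL.refl \<epsilon>(1) expand F
          annihilator_subspace[OF vs_H1 vs_W' q'_bilinear FV] comm half])
  then show "ereal (\<epsilon>\<^sup>2 / (1 + \<epsilon>)) \<le> ereal (triple_cheeger_at L (H 1) W' q' F)"
    using pos unfolding triple_cheeger_at_def Let_def by (simp add: pos_le_divide_eq)
qed

text \<open>The dual basis serves both as spanning set and as basis. The dual class of \<open>v\<close> can pair
  nontrivially only with the dual classes of the neighbours of \<open>v\<close> and, because of the added square,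
  with itself; this is the reason for the successor.\<close>

lemma valence_le:
  assumes deg: "\<And>v. v \<in> verts \<Gamma> \<Longrightarrow> card {w \<in> verts \<Gamma>. {v, w} \<in> edges \<Gamma>} \<le> N"
  shows "valence L (H 1) W' q' \<le> Suc N"
proof -
  let ?e = "dual_class L \<Gamma>" and ?B = "dual_class L \<Gamma> ` verts \<Gamma>"
  have B: "basis ?B" by (rule basis_e)
  have ne: "?B \<noteq> {}" using v0 by blast
  have count: "card {b \<in> ?B. q' (?e v) b \<noteq> \<zero>\<^bsub>W'\<^esub>} \<le> Suc N" if v: "v \<in> verts \<Gamma>" for v
  proof -
    let ?N = "insert v {w \<in> verts \<Gamma>. {v, w} \<in> edges \<Gamma>}"
    have zero: "q' (?e v) (?e w) = \<zero>\<^bsub>W'\<^esub>" if w: "w \<in> verts \<Gamma>" and not: "w \<notin> ?N" for w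
    proof -
      have "coord a (?e v) \<otimes>\<^bsub>L\<^esub> coord b (?e w) = coord b (?e v) \<otimes>\<^bsub>L\<^esub> coord a (?e w)"
        if e: "{a, b} \<in> edges \<Gamma>" for a b
        using e w not edge_verts[OF e] dual_class(2)[OF v, of a] dual_class(2)[OF v, of b]
          dual_class(2)[OF w, of a] dual_class(2)[OF w, of b]
        by (auto simp: insert_commute)
      then have "raag_cup L \<Gamma> (?e v) (?e w) = \<zero>\<^bsub>H 2\<^esub>"
        using cup_eq_zero_iff_edges[OF dual_class(1)[OF v] dual_class(1)[OF w]] by blast
      then show ?thesis using not q0_dual[OF v w] by (auto simp: q'_eq_zero_iff)
    qed
    have fin: "finite ?N" using finite_index by simp
    have "{b \<in> ?B. q' (?e v) b \<noteq> \<zero>\<^bsub>W'\<^esub>} \<subseteq> ?e ` ?N" using zero by blast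
    then have "card {b \<in> ?B. q' (?e v) b \<noteq> \<zero>\<^bsub>W'\<^esub>} \<le> card (?e ` ?N)"
      using fin by (intro card_mono) auto
    also have "\<dots> \<le> card ?N" by (rule card_image_le[OF fin])
    also have "\<dots> \<le> Suc (card {w \<in> verts \<Gamma>. {v, w} \<in> edges \<Gamma>})" by (rule card_insert_le_m1) simp_all
    finally show ?thesis using deg[OF v] by simp
  qed
  have "valence L (H 1) W' q' \<le> valence_set L (H 1) W' q' ?B"
    unfolding valence_def
  proof (rule cINF_lower)
    show "?B \<in> {S. S \<noteq> {} \<and> S \<subseteq> carrier (H 1) \<and> span S = carrier (H 1)}"
      using B ne unfolding basis_def by blast
  qed simp
  also have "\<dots> \<le> valence_basis W' q' ?B ?B"
    unfolding valence_set_def by (rule cINF_lower) (use B in simp_all)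
  also have "\<dots> \<le> Suc N"
    unfolding valence_basis_def using count ne finite_index by (intro Max.boundedI) auto
  finally show ?thesis .
qed

text \<open>The cup product of the Artin group of \<open>\<Lambda>\<close> is alternating, and an isomorphism of triples would
  transport this to \<open>q'\<close>, whose value at the dual class of \<open>v0\<close> taken twice is nonzero. Alternation
  is used instead of anti-symmetry because in characteristic two \<open>q'\<close> is anti-symmetric.\<close>

lemma not_raag_triple:
  assumes \<Lambda>: "fin_simplicial \<Lambda>"
  shows "\<not> triple_iso L (H 1) W' q' (raag_H L \<Lambda> 1) (raag_H L \<Lambda> 2) (raag_cup L \<Lambda>)"
proof
  interpret \<Lambda>: raag_cohomology L \<Lambda> using \<Lambda> by unfold_locales
  assume "triple_iso L (H 1) W' q' (raag_H L \<Lambda> 1) (raag_H L \<Lambda> 2) (raag_cup L \<Lambda>)"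
  then obtain \<phi> \<psi> where \<phi>: "\<phi> \<in> LinearCombinations.module_hom L (H 1) (\<Lambda>.H 1)"
    and \<psi>: "\<psi> \<in> LinearCombinations.module_hom L W' (\<Lambda>.H 2)"
    and bij: "bij_betw \<psi> (carrier W') (carrier (\<Lambda>.H 2))"
    and eq: "\<And>x y. \<lbrakk>x \<in> carrier (H 1); y \<in> carrier (H 1)\<rbrakk> \<Longrightarrow> raag_cup L \<Lambda> (\<phi> x) (\<phi> y) = \<psi> (q' x y)"
    unfolding triple_iso_def by blast
  interpret W: vectorspace L W' by (rule vs_W')
  have "vectorspace L (\<Lambda>.H 2)" by (rule \<Lambda>.cohomology_simps) simp
  then interpret W2: vectorspace L "\<Lambda>.H 2" .
  interpret \<psi>: mod_hom L W' "\<Lambda>.H 2" \<psi> using \<psi> by unfold_locales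
  let ?e = "dual_class L \<Gamma> v0"
  have e: "?e \<in> carrier (H 1)" by (rule dual_class(1)[OF v0])
  have "\<phi> ?e \<in> carrier (\<Lambda>.H 1)" using \<phi> e unfolding LinearCombinations.module_hom_def by blast
  then have "\<psi> (q' ?e ?e) = \<psi> \<zero>\<^bsub>W'\<^esub>"
    using eq[OF e e] \<Lambda>.cup_alternating by simp
  then have "q' ?e ?e = \<zero>\<^bsub>W'\<^esub>"
    using bij bilinear_pairingD(1)[OF q'_bilinear e e] unfolding bij_betw_def
    by (meson W.M.zero_closed inj_onD)
  then show False using q0_dual[OF v0 v0] by (simp add: q'_eq_zero_iff)
qed

end

theorem proposition5p1:
  fixes L :: "('l, 'm) ring_scheme"
    and \<Gamma> :: "nat \<Rightarrow> 'v sgraph"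
    and v0 :: "nat \<Rightarrow> 'v"
    and q0 :: "nat \<Rightarrow> ('v word set list \<Rightarrow> 'l) set \<Rightarrow> ('v word set list \<Rightarrow> 'l) set \<Rightarrow> 'l"
    and W' :: "nat \<Rightarrow> ('l, ('v word set list \<Rightarrow> 'l) set \<times> 'l) module"
    and q' :: "nat \<Rightarrow> ('v word set list \<Rightarrow> 'l) set \<Rightarrow> ('v word set list \<Rightarrow> 'l) set \<Rightarrow>
                 ('v word set list \<Rightarrow> 'l) set \<times> 'l"
  assumes "field L"
    and "graph_expander_family \<Gamma>"
    and "\<And>i. v0 i \<in> verts (\<Gamma> i)"
    and "\<And>i. bilinear_pairing L (raag_H L (\<Gamma> i) 1) (line L) (q0 i)"
    and "\<And>i v w. v \<in> verts (\<Gamma> i) \<Longrightarrow> w \<in> verts (\<Gamma> i) \<Longrightarrow>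
           q0 i (dual_class L (\<Gamma> i) v) (dual_class L (\<Gamma> i) w) =
             (if v = v0 i \<and> w = v0 i then \<one>\<^bsub>L\<^esub> else \<zero>\<^bsub>L\<^esub>)"
    and "\<And>i. W' i = direct_sum (raag_H L (\<Gamma> i) 2) (line L)"
    and "\<And>i x y. q' i x y = (raag_cup L (\<Gamma> i) x y, q0 i x y)"
  shows "vs_expander_family L (\<lambda>i. raag_H L (\<Gamma> i) 1) W' q' \<and>
         \<not> (\<exists>\<Lambda> :: nat \<Rightarrow> 'w sgraph.
              (\<forall>i. fin_simplicial (\<Lambda> i) \<and> connected_graph (\<Lambda> i)) \<and>
              (\<forall>i. triple_iso L (raag_H L (\<Gamma> i) 1) (W' i) (q' i)
                     (raag_H L (\<Lambda> i) 1) (raag_H L (\<Lambda> i) 2) (raag_cup L (\<Lambda> i))))"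
proof (intro conjI notI)
  have simplicial: "fin_simplicial (\<Gamma> i)" for i
    using assms(2) unfolding graph_expander_family_def by blast
  have raag: "raag_cohomology L (\<Gamma> i)" for i
    using assms(1) simplicial by (intro raag_cohomology.intro raag_cohomology_axioms.intro)
  have loc: "perturbed_cup L (\<Gamma> i) (v0 i) (q0 i)" for i
    using raag assms(3-5) by (intro perturbed_cup.intro perturbed_cup_axioms.intro)
  have W': "W' i = perturbed_cup.W' L (\<Gamma> i)" and q': "q' i = perturbed_cup.q' L (\<Gamma> i) (q0 i)" for i
    using assms(6,7) by (auto simp: perturbed_cup.W'_def[OF loc] perturbed_cup.q'_def[OF loc] fun_eq_iff)
  show "vs_expander_family L (\<lambda>i. raag_H L (\<Gamma> i) 1) W' q'"
    unfolding vs_expander_family_def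
  proof (intro conjI allI)
    show "is_triple L (raag_H L (\<Gamma> i) 1) (W' i) (q' i)" for i
      unfolding W' q' by (rule perturbed_cup.triple[OF loc])
    have "vectorspace.dim L (raag_H L (\<Gamma> i) 1) = card (verts (\<Gamma> i))" for i
      by (rule coordinates.dim_eq_card[OF raag_cohomology.coordinates_H1[OF raag]])
    then show "filterlim (\<lambda>i. vectorspace.dim L (raag_H L (\<Gamma> i) 1)) at_top sequentially"
      using assms(2) unfolding graph_expander_family_def by simp
    obtain N where "\<And>i v. v \<in> verts (\<Gamma> i) \<Longrightarrow> card {w \<in> verts (\<Gamma> i). {v, w} \<in> edges (\<Gamma> i)} \<le> N"
      using assms(2) unfolding graph_expander_family_def by blast
    then have "valence L (raag_H L (\<Gamma> i) 1) (W' i) (q' i) \<le> Suc N" for i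
      unfolding W' q' by (intro perturbed_cup.valence_le[OF loc])
    then show "\<exists>N. \<forall>i. valence L (raag_H L (\<Gamma> i) 1) (W' i) (q' i) \<le> N" by blast
    have "0 < (INF i. graph_cheeger (\<Gamma> i))"
      using assms(2) unfolding graph_expander_family_def by blast
    from ereal_dense2[OF this] obtain \<epsilon> :: real
      where \<epsilon>: "0 < \<epsilon>" "\<epsilon> < (INF i. graph_cheeger (\<Gamma> i))" by auto
    have "\<epsilon> \<le> graph_cheeger (\<Gamma> i)" for i
      by (rule order_trans[OF less_imp_le[OF \<epsilon>(2)] INF_lower]) simp
    then have "ereal (\<epsilon>\<^sup>2 / (1 + \<epsilon>)) \<le> triple_cheeger L (raag_H L (\<Gamma> i) 1) (W' i) (q' i)" for i
      unfolding W' q' by (intro perturbed_cup.cheeger_ge[OF loc] \<epsilon>(1))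
    then have "ereal (\<epsilon>\<^sup>2 / (1 + \<epsilon>)) \<le> (INF i. triple_cheeger L (raag_H L (\<Gamma> i) 1) (W' i) (q' i))"
      by (intro INF_greatest)
    moreover have "0 < ereal (\<epsilon>\<^sup>2 / (1 + \<epsilon>))" using \<epsilon>(1) by simp
    ultimately show "0 < (INF i. triple_cheeger L (raag_H L (\<Gamma> i) 1) (W' i) (q' i))"
      by (rule less_le_trans[rotated])
  qed
  assume "\<exists>\<Lambda> :: nat \<Rightarrow> 'w sgraph. (\<forall>i. fin_simplicial (\<Lambda> i) \<and> connected_graph (\<Lambda> i)) \<and>
    (\<forall>i. triple_iso L (raag_H L (\<Gamma> i) 1) (W' i) (q' i)
       (raag_H L (\<Lambda> i) 1) (raag_H L (\<Lambda> i) 2) (raag_cup L (\<Lambda> i)))"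
  then obtain \<Lambda> :: "nat \<Rightarrow> 'w sgraph" where "fin_simplicial (\<Lambda> 0)"
    "triple_iso L (raag_H L (\<Gamma> 0) 1) (W' 0) (q' 0)
       (raag_H L (\<Lambda> 0) 1) (raag_H L (\<Lambda> 0) 2) (raag_cup L (\<Lambda> 0))" by blast
  then show False
    unfolding W' q' using perturbed_cup.not_raag_triple[OF loc] by blast
qed

end
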